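(* Let $(C_n)$ be a recurrent Markov chain on a discrete state space ${\cal S}$ with transition matrix $P=(p(x,y))$, which is irreducible, aperiodic and without loops ($p(x,x)=0$ for all $x\in{\cal S}$), and let $\pi$ be an invariant measure of $P$ (not necessarily of finite mass). Then the cat and mouse Markov chain $(C_n,M_n)$ on ${\cal S}\times{\cal S}$ associated with $P$ is recurrent: the measure $\nu$ defined by $$\nu(x,y)=\pi(x)\,\mathbb{E}_x\Bigl(\sum_{n=1}^{H_y^*}p(C_n^*,y)\Bigr),\qquad x,y\in{\cal S},$$ is invariant for $(C_n,M_n)$. Its marginal on the second coordinate is given, for $y\in{\cal S}$, by $$\nu_2(y):=\sum_{x\in{\cal S}}\nu(x,y)=\mathbb{E}_\pi\bigl(p(C_0,y)H_y\bigr),$$ and $\nu$ is equal to $\pi$ on the diagonal: $\nu(x,x)=\pi(x)$ for $x\in{\cal S}$.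
   Context: The cat and mouse Markov chain $(C_n,M_n)$ associated with $P$ is the Markov chain on ${\cal S}\times{\cal S}$ with transition matrix $Q=(q(\cdot,\cdot))$ given, for $x,y,z,w\in{\cal S}$, by $q[(x,y),(z,y)]=p(x,z)$ if $x\neq y$, and $q[(y,y),(z,w)]=p(y,z)p(y,w)$; all other transitions have probability $0$. The first coordinate $(C_n)$ is itself a Markov chain with transition matrix $P$. $(C_n^* )$ denotes the reversed Markov chain, with transition matrix $p^*(x,y)=\frac{\pi(y)}{\pi(x)}p(y,x)$. For $y\in{\cal S}$, $H_y^*=\inf\{n>0: C_n^*=y\}$ and $H_y=\inf\{n>0: C_n=y\}$. $\mathbb{E}_x$ is expectation when the chain starts at $x$, and $\mathbb{E}_\pi(\cdot)=\sum_x\pi(x)\mathbb{E}_x(\cdot)$. The chain $(C_n,M_n)$ need not be irreducible on ${\cal S}\times{\cal S}$, but it has only one irreducible (closed) component. Recurrence of $(C_n,M_n)$ means that, with probability $1$, the elements of ${\cal S}\times{\cal S}$ for which $\nu$ is nonzero are visited infinitely often. *)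

theory Defs
  imports "HOL-Probability.Probability"
begin

text \<open>
  The state space is a type of class \<open>countable\<close>, with the discrete sigma-algebra. A transition
  matrix is a function \<open>p :: 'a \<Rightarrow> 'a \<Rightarrow> real\<close>. Sums over the state space are
  nonnegative integrals with respect to \<^const>\<open>count_space\<close>, hence always defined in
  \<^typ>\<open>ennreal\<close>.
\<close>

definition stochastic_matrix :: "('a \<Rightarrow> 'a \<Rightarrow> real) \<Rightarrow> bool" where
  "stochastic_matrix p \<longleftrightarrow>
     (\<forall>x y. 0 \<le> p x y) \<and> (\<forall>x. (\<integral>\<^sup>+y. ennreal (p x y) \<partial>count_space UNIV) = 1)"

lemma pmf_embed_stochastic:
  "stochastic_matrix p \<Longrightarrow> pmf (embed_pmf (p x)) y = p x y"
  by (rule pmf_embed_pmf) (auto simp: stochastic_matrix_def)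

text \<open>
  The law of the chain on path space is obtained from the Ionescu-Tulcea theorem:
  \<open>chain_kernel p x n \<omega>\<close> is the conditional law of the \<open>n\<close>-th position given the
  positions \<open>\<omega> 0, \<dots>, \<omega> (n - 1)\<close>.
\<close>

definition chain_kernel ::
    "('a \<Rightarrow> 'a \<Rightarrow> real) \<Rightarrow> 'a \<Rightarrow> nat \<Rightarrow> (nat \<Rightarrow> 'a) \<Rightarrow> 'a measure" where
  "chain_kernel p x n \<omega> =
     measure_pmf (case n of 0 \<Rightarrow> return_pmf x | Suc m \<Rightarrow> embed_pmf (p (\<omega> m)))"

lemma Ionescu_Tulcea_chain_kernel:
  fixes p :: "'a::countable \<Rightarrow> 'a \<Rightarrow> real"
  shows "Ionescu_Tulcea (chain_kernel p x) (\<lambda>_. count_space UNIV)"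
proof (rule Ionescu_Tulcea.intro)
  fix i
  show "chain_kernel p x i \<in>
      PiM {0..<i} (\<lambda>_. count_space UNIV) \<rightarrow>\<^sub>M subprob_algebra (count_space UNIV)"
  proof (cases i)
    case 0
    then show ?thesis
      unfolding chain_kernel_def by (simp add: measure_pmf_in_subprob_algebra)
  next
    case (Suc m)
    have "(\<lambda>\<omega>. \<omega> m) \<in> PiM {0..<i} (\<lambda>_. count_space UNIV) \<rightarrow>\<^sub>M count_space (UNIV :: 'a set)"
      using Suc by (intro measurable_component_singleton) auto
    moreover have "(\<lambda>z. measure_pmf (embed_pmf (p z))) \<in>
        count_space UNIV \<rightarrow>\<^sub>M subprob_algebra (count_space UNIV)"
      by (auto simp: measure_pmf_in_subprob_algebra)
    ultimately show ?thesis
      unfolding Suc chain_kernel_def by (auto intro: measurable_compose)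
  qed
qed (simp add: chain_kernel_def measure_pmf.prob_space_axioms)

definition chain_law :: "('a \<Rightarrow> 'a \<Rightarrow> real) \<Rightarrow> 'a \<Rightarrow> (nat \<Rightarrow> 'a) measure" where
  "chain_law p x = projective_family.lim UNIV
     (Ionescu_Tulcea.CI (chain_kernel p x) (\<lambda>_. count_space UNIV)) (\<lambda>_. count_space UNIV)"

lemma sets_chain_law:
  fixes p :: "'a::countable \<Rightarrow> 'a \<Rightarrow> real"
  shows "sets (chain_law p x) = sets (PiM UNIV (\<lambda>_. count_space UNIV))"
proof -
  interpret Ionescu_Tulcea "chain_kernel p x" "\<lambda>_. count_space UNIV"
    by (rule Ionescu_Tulcea_chain_kernel)
  show ?thesis by (simp add: chain_law_def)
qed

lemma prob_space_chain_law:
  fixes p :: "'a::countable \<Rightarrow> 'a \<Rightarrow> real"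
  shows "prob_space (chain_law p x)"
proof
  interpret Ionescu_Tulcea "chain_kernel p x" "\<lambda>_. count_space UNIV"
    by (rule Ionescu_Tulcea_chain_kernel)
  have "emeasure PF.lim (PF.emb UNIV {} {\<lambda>_. undefined}) = emeasure (CI {}) {\<lambda>_. undefined}"
    by (rule lim) (auto simp: PiM_empty)
  moreover have "emeasure (CI {}) {\<lambda>_. undefined} = 1"
    using prob_space.emeasure_space_1[OF PF.prob_space_P[of "{}"]]
    by (simp add: CI_def space_PiM)
  moreover have "PF.emb UNIV {} {\<lambda>_. undefined} = space PF.lim"
    by (auto simp: prod_emb_def space_PiM)
  ultimately show "emeasure (chain_law p x) (space (chain_law p x)) = 1"
    unfolding chain_law_def by simp
qed

lemma emeasure_chain_law_cylinder:
  fixes p :: "'a::countable \<Rightarrow> 'a \<Rightarrow> real"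
  assumes p: "stochastic_matrix p"
  shows "emeasure (chain_law p x) {\<omega>. \<forall>i\<le>n. \<omega> i = s i} =
    (if s 0 = x then ennreal (\<Prod>i<n. p (s i) (s (Suc i))) else 0)"
proof -
  interpret Ionescu_Tulcea "chain_kernel p x" "\<lambda>_. count_space UNIV"
    by (rule Ionescu_Tulcea_chain_kernel)
  let ?M = "\<lambda>_::nat. count_space (UNIV :: 'a set)"
  let ?u = "\<lambda>_::nat. undefined :: 'a"
  define A where "A m = {restrict s {0..<m}}" for m
  have A_PiE: "A m = PiE {0..<m} (\<lambda>i. {s i})" for m
    by (auto simp: A_def PiE_iff extensional_def fun_eq_iff)
  have A_sets [measurable]: "A m \<in> sets (PiM {0..<m} ?M)" for m
    unfolding A_PiE by (intro sets_PiM_I_finite) auto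
  have eP_A: "emeasure (eP m \<omega>) (A (Suc m)) =
      indicator (A m) \<omega> * emeasure (chain_kernel p x m s) {s m}"
    if "\<omega> \<in> space (PiM {0..<m} ?M)" for m \<omega>
  proof -
    have "emeasure (eP m \<omega>) (A (Suc m)) =
        emeasure (chain_kernel p x m \<omega>) ((\<lambda>z. fun_upd \<omega> m z) -` A (Suc m) \<inter> UNIV)"
      using emeasure_eP[OF that A_sets] by simp
    moreover have "(\<lambda>z. fun_upd \<omega> m z) -` A (Suc m) \<inter> UNIV = (if \<omega> \<in> A m then {s m} else {})"
    proof -
      have ext: "\<omega> j = undefined" if "j \<ge> m" for j
        using \<open>\<omega> \<in> space _\<close> that by (auto simp: space_PiM PiE_iff extensional_def)
      have "fun_upd \<omega> m z = restrict s {0..<Suc m} \<longleftrightarrow> \<omega> = restrict s {0..<m} \<and> z = s m" for z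
        using ext by (auto simp: fun_eq_iff less_Suc_eq)
      then show ?thesis by (auto simp: A_def)
    qed
    moreover have "chain_kernel p x m \<omega> = chain_kernel p x m s" if "\<omega> \<in> A m"
      using that by (auto simp: chain_kernel_def A_def split: nat.split)
    ultimately show ?thesis by (auto split: split_indicator)
  qed
  have C_A: "emeasure (C 0 m ?u) (A m) = (\<Prod>i<m. emeasure (chain_kernel p x i s) {s i})" for m
  proof (induction m)
    case 0
    then show ?case by (simp add: A_def PiM_empty restrict_def)
  next
    case (Suc m)
    have u: "?u \<in> space (PiM {0..<0} ?M)" by (simp add: space_PiM)
    have "emeasure (C 0 (Suc m) ?u) (A (Suc m)) = (\<integral>\<^sup>+\<omega>. emeasure (eP m \<omega>) (A (Suc m)) \<partial>C 0 m ?u)"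
      using prob_space.not_empty[OF prob_space_C[OF u, of m]]
      by (simp add: emeasure_bind[OF _ _ A_sets] measurable_cong_sets[OF sets_C[OF u] refl])
    also have "\<dots> = (\<integral>\<^sup>+\<omega>. emeasure (chain_kernel p x m s) {s m} * indicator (A m) \<omega> \<partial>C 0 m ?u)"
      using space_C[OF u, of m] by (intro nn_integral_cong) (simp add: eP_A mult.commute)
    also have "\<dots> = emeasure (chain_kernel p x m s) {s m} * emeasure (C 0 m ?u) (A m)"
      using sets_C[OF u, of m] by (intro nn_integral_cmult_indicator) (simp add: A_sets)
    finally show ?case by (simp add: Suc.IH mult.commute)
  qed
  have "{\<omega>. \<forall>i\<le>n. \<omega> i = s i} = PF.emb UNIV {0..<Suc n} (A (Suc n))"
    by (auto simp: prod_emb_def space_PiM A_PiE PiE_iff less_Suc_eq_le)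
  then have "emeasure (chain_law p x) {\<omega>. \<forall>i\<le>n. \<omega> i = s i} = emeasure (CI {0..<Suc n}) (A (Suc n))"
    unfolding chain_law_def by (simp only: lim[OF finite_atLeastLessThan A_sets])
  also have "\<dots> = emeasure (C 0 (Suc n) ?u) (A (Suc n))"
    by (subst emeasure_CI[of _ "Suc n"]) (auto simp: A_sets A_PiE prod_emb_id PiE_iff simp del: C.simps)
  also have "\<dots> = (\<Prod>i<Suc n. emeasure (chain_kernel p x i s) {s i})"
    by (rule C_A)
  also have "\<dots> = (if s 0 = x then 1 else 0) * (\<Prod>i<n. ennreal (p (s i) (s (Suc i))))"
    by (subst prod.lessThan_Suc_shift)
      (simp add: chain_kernel_def emeasure_pmf_single pmf_embed_stochastic[OF p] indicator_def)
  also have "(\<Prod>i<n. ennreal (p (s i) (s (Suc i)))) = ennreal (\<Prod>i<n. p (s i) (s (Suc i)))"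
    using p by (intro prod_ennreal) (simp add: stochastic_matrix_def)
  finally show ?thesis by simp
qed

definition irreducible_chain :: "('a \<Rightarrow> 'a \<Rightarrow> real) \<Rightarrow> bool" where
  "irreducible_chain p \<longleftrightarrow> (\<forall>x y. \<exists>n. \<P>(\<omega> in chain_law p x. \<omega> n = y) > 0)"

definition aperiodic_chain :: "('a \<Rightarrow> 'a \<Rightarrow> real) \<Rightarrow> bool" where
  "aperiodic_chain p \<longleftrightarrow> (\<forall>x. Gcd {n. n > 0 \<and> \<P>(\<omega> in chain_law p x. \<omega> n = x) > 0} = 1)"

text \<open>The infimum of the empty set is \<open>\<infinity>\<close>.\<close>

definition hitting_time :: "'a \<Rightarrow> (nat \<Rightarrow> 'a) \<Rightarrow> enat" where
  "hitting_time y \<omega> = Inf (enat ` {n. n > 0 \<and> \<omega> n = y})"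

definition recurrent_chain :: "('a \<Rightarrow> 'a \<Rightarrow> real) \<Rightarrow> bool" where
  "recurrent_chain p \<longleftrightarrow> (\<forall>x. AE \<omega> in chain_law p x. hitting_time x \<omega> < \<infinity>)"

text \<open>
  An invariant measure is nonzero and gives finite mass to points; its total mass may be infinite.
  For an irreducible matrix it is then positive at every point, so that the quotient in
  \<open>reversed\<close> below is meaningful.
\<close>

definition invariant_measure :: "('a \<Rightarrow> 'a \<Rightarrow> real) \<Rightarrow> ('a \<Rightarrow> ennreal) \<Rightarrow> bool" where
  "invariant_measure p \<mu> \<longleftrightarrow>
     (\<exists>x. \<mu> x \<noteq> 0) \<and> (\<forall>x. \<mu> x < \<infinity>) \<and>
     (\<forall>y. (\<integral>\<^sup>+x. \<mu> x * ennreal (p x y) \<partial>count_space UNIV) = \<mu> y)"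

definition reversed :: "('a \<Rightarrow> 'a \<Rightarrow> real) \<Rightarrow> ('a \<Rightarrow> real) \<Rightarrow> 'a \<Rightarrow> 'a \<Rightarrow> real" where
  "reversed p \<pi> x y = \<pi> y / \<pi> x * p y x"

lemma stochastic_reversed:
  assumes "stochastic_matrix p" "\<And>x. \<pi> x > 0" "invariant_measure p (\<lambda>x. ennreal (\<pi> x))"
  shows "stochastic_matrix (reversed p \<pi>)"
  unfolding stochastic_matrix_def
proof (intro conjI allI)
  have p: "0 \<le> p x y" for x y
    using assms(1) by (simp add: stochastic_matrix_def)
  then show "0 \<le> reversed p \<pi> x y" for x y
    using assms(2)[of x] assms(2)[of y] by (simp add: reversed_def)
  fix x
  have "ennreal (reversed p \<pi> x y) = ennreal (1 / \<pi> x) * (ennreal (\<pi> y) * ennreal (p y x))" for y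
    using assms(2)[of x] assms(2)[of y] p[of y x]
    by (simp add: reversed_def flip: ennreal_mult)
  then have "(\<integral>\<^sup>+y. ennreal (reversed p \<pi> x y) \<partial>count_space UNIV) =
      ennreal (1 / \<pi> x) * (\<integral>\<^sup>+y. ennreal (\<pi> y) * ennreal (p y x) \<partial>count_space UNIV)"
    by (simp add: nn_integral_cmult)
  also have "\<dots> = ennreal (1 / \<pi> x) * ennreal (\<pi> x)"
    using assms(3) by (simp add: invariant_measure_def)
  also have "\<dots> = 1"
    using assms(2)[of x] by (simp flip: ennreal_mult)
  finally show "(\<integral>\<^sup>+y. ennreal (reversed p \<pi> x y) \<partial>count_space UNIV) = 1" .
qed

definition cat_mouse :: "('a \<Rightarrow> 'a \<Rightarrow> real) \<Rightarrow> 'a \<times> 'a \<Rightarrow> 'a \<times> 'a \<Rightarrow> real" where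
  "cat_mouse p = (\<lambda>(x, y) (z, w).
     if x = y then p y z * p y w else if w = y then p x z else 0)"

lemma stochastic_cat_mouse:
  fixes p :: "'a::countable \<Rightarrow> 'a \<Rightarrow> real"
  assumes "stochastic_matrix p"
  shows "stochastic_matrix (cat_mouse p)"
  unfolding stochastic_matrix_def
proof (intro conjI allI)
  have p: "0 \<le> p x y" "(\<integral>\<^sup>+y. ennreal (p x y) \<partial>count_space UNIV) = 1" for x y
    using assms by (simp_all add: stochastic_matrix_def)
  then show "0 \<le> cat_mouse p s t" for s t
    by (auto simp: cat_mouse_def split: prod.splits)
  fix s :: "'a \<times> 'a"
  obtain x y where s: "s = (x, y)" by force
  have "(\<integral>\<^sup>+t. ennreal (cat_mouse p s t) \<partial>count_space UNIV) =
      (\<integral>\<^sup>+z. \<integral>\<^sup>+w. ennreal (cat_mouse p s (z, w)) \<partial>count_space UNIV \<partial>count_space UNIV)"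
    by (rule nn_integral_fst_count_space[symmetric])
  also have "\<dots> = 1"
  proof (cases "x = y")
    case True
    then show ?thesis
      by (simp add: s cat_mouse_def p ennreal_mult nn_integral_cmult)
  next
    case False
    have "(\<integral>\<^sup>+w. ennreal (if w = y then p x z else 0) \<partial>count_space UNIV) =
        (\<integral>\<^sup>+w. ennreal (p x z) * indicator {y} w \<partial>count_space UNIV)" for z
      by (intro nn_integral_cong) (auto split: split_indicator)
    then show ?thesis
      using False by (simp add: s cat_mouse_def p nn_integral_cmult_indicator)
  qed
  finally show "(\<integral>\<^sup>+t. ennreal (cat_mouse p s t) \<partial>count_space UNIV) = 1" .
qed

definition cat_mouse_measure :: "('a \<Rightarrow> 'a \<Rightarrow> real) \<Rightarrow> ('a \<Rightarrow> real) \<Rightarrow> 'a \<Rightarrow> 'a \<Rightarrow> ennreal" where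
  "cat_mouse_measure p \<pi> x y = ennreal (\<pi> x) *
     (\<integral>\<^sup>+\<omega>. (\<integral>\<^sup>+n. ennreal (p (\<omega> n) y) \<partial>count_space {n. 1 \<le> n \<and> enat n \<le> hitting_time y \<omega>})
       \<partial>chain_law (reversed p \<pi>) x)"

text \<open>The expectation for the initial measure \<open>\<pi>\<close>, which need not be a probability measure.\<close>

definition stationary_expectation ::
    "('a \<Rightarrow> 'a \<Rightarrow> real) \<Rightarrow> ('a \<Rightarrow> real) \<Rightarrow> ((nat \<Rightarrow> 'a) \<Rightarrow> ennreal) \<Rightarrow> ennreal" where
  "stationary_expectation p \<pi> f =
     (\<integral>\<^sup>+x. ennreal (\<pi> x) * (\<integral>\<^sup>+\<omega>. f \<omega> \<partial>chain_law p x) \<partial>count_space UNIV)"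

end

theory Submission
  imports Defs
begin

text \<open>
  Time reversal turns \<open>\<nu>\<close> into a statement about the original chain. A path of the reversed chain
  from \<open>x\<close> to \<open>z\<close> avoiding \<open>y\<close> in between is, read backwards, a path of \<open>p\<close> from \<open>z\<close> to \<open>x\<close> with the
  same property, and \<open>\<pi> x\<close> times the weight of the one is \<open>\<pi> z\<close> times the weight of the other
  (\<open>taboo_reversed\<close>). Hence
  \<open>\<nu>(x, y) = \<Sum>z. \<pi>(z) p(z, y) G\<^sub>y(z, x)\<close>
  (\<open>cat_mouse_measure_eq_green\<close>), where \<open>G\<^sub>y(z, x)\<close> is the expected number of visits to \<open>x\<close> at times
  from \<open>1\<close> to \<open>H\<^sub>y\<close> of the chain started at \<open>z\<close>. In words: cat and mouse part at \<open>z\<close>, the mouse moves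
  to \<open>y\<close>, and one counts where the cat goes until it catches the mouse again.

  Three of the claims can be read off from this formula. On the diagonal, \<open>G\<^sub>y(z, y)\<close> is the probability that
  \<open>y\<close> is hit, which is \<open>1\<close>, and what remains is the invariance of \<open>\<pi>\<close>. Summing \<open>G\<^sub>y(z, x)\<close> over \<open>x\<close>
  gives \<open>E\<^sub>z(H\<^sub>y)\<close>, which is the marginal. Splitting off the last step of the cat
  (\<open>cat_mouse_measure_last_step\<close>) is the invariance equation: the cat either has just left
  the meeting point, or it came from a state different from \<open>y\<close>. Finiteness of \<open>\<nu>(\<cdot>, y)\<close> holds at \<open>y\<close>
  and spreads backwards along the edges of \<open>p\<close> by the same equation.

  For the recurrence, let \<open>h(s)\<close> be the probability that the pair chain started at \<open>s\<close> ever visits a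
  given \<open>e = (x, y)\<close> with \<open>\<nu>(e) \<noteq> 0\<close>. This function is superharmonic. While the mouse sits at \<open>y\<close> the cat
  moves by \<open>p\<close> and is certain to reach \<open>y\<close>, so \<open>h(x, y) \<ge> h(y, y)\<close>; consequently \<open>y \<mapsto> h(y, y)\<close> is
  superharmonic for \<open>p\<close> (the successive meeting points follow the mouse, hence \<open>p\<close>), which gives
  \<open>h(y, y) \<ge> h(t, t)\<close> for all \<open>t\<close> (\<open>hit_prob_cat_mouse_ge\<close>). The formula for \<open>\<nu>\<close> shows that \<open>e\<close> is
  accessible from some diagonal state, so \<open>h\<close> is bounded below by a positive constant. A state that is
  hit with probability bounded below from everywhere is hit almost surely from everywhere
  (\<open>AE_hit_of_hit_prob_bounded_below\<close>), hence infinitely often.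
\<close>

section \<open>Conditioning on the first step\<close>

abbreviation path_space :: "(nat \<Rightarrow> 'a) measure" where
  "path_space \<equiv> PiM UNIV (\<lambda>_. count_space UNIV)"

text \<open>
  Cylinders, together with the empty set, form a generator of the product sigma-algebra that is stable
  under intersection, so a law on paths is determined by its values on them.
\<close>

definition path_cylinder :: "nat \<Rightarrow> (nat \<Rightarrow> 'a) \<Rightarrow> (nat \<Rightarrow> 'a) set" where
  "path_cylinder n s = {\<omega>. \<forall>i\<le>n. \<omega> i = s i}"

lemma path_cylinder_measurable [measurable]:
  "path_cylinder n s \<in> sets (path_space :: (nat \<Rightarrow> 'a::countable) measure)"
proof -
  have "{\<omega> \<in> space path_space. \<forall>i\<le>n. \<omega> i = s i} \<in> sets (path_space :: (nat \<Rightarrow> 'a) measure)"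
    by measurable
  then show ?thesis by (simp add: path_cylinder_def space_PiM)
qed

lemma sets_path_space:
  "sets (path_space :: (nat \<Rightarrow> 'a::countable) measure) =
     sigma_sets UNIV (insert {} {path_cylinder n s | n s. True})" (is "_ = sigma_sets UNIV ?E")
proof
  interpret E: sigma_algebra UNIV "sigma_sets UNIV ?E"
    by (rule sigma_algebra_sigma_sets) auto
  have "{\<omega>. \<omega> i \<in> A} \<in> sigma_sets UNIV ?E" for i and A :: "'a set"
  proof -
    \<comment> \<open>Prefixes are taken as lists because there are only countably many of them.\<close>
    have "{\<omega>. \<omega> i \<in> A} =
        (\<Union>xs\<in>{xs. length xs = Suc i \<and> xs ! i \<in> A}. path_cylinder i ((!) xs))" (is "_ = ?U")
    proof
      show "?U \<subseteq> {\<omega>. \<omega> i \<in> A}" by (auto simp: path_cylinder_def)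
      show "{\<omega>. \<omega> i \<in> A} \<subseteq> ?U"
      proof
        fix \<omega> assume "\<omega> \<in> {\<omega>. \<omega> i \<in> A}"
        then show "\<omega> \<in> ?U"
          by (intro UN_I[of "map \<omega> [0..<Suc i]"])
            (auto simp: path_cylinder_def nth_append simp del: upt_Suc)
      qed
    qed
    also have "\<dots> \<in> sigma_sets UNIV ?E"
      by (intro E.countable_UN' sigma_sets.Basic) auto
    finally show ?thesis .
  qed
  then have "sigma_sets UNIV {{\<omega>. \<omega> i \<in> A} | i A. True} \<subseteq> sigma_sets UNIV ?E"
    by (intro E.sigma_sets_subset) auto
  then show "sets (path_space :: (nat \<Rightarrow> 'a) measure) \<subseteq> sigma_sets UNIV ?E"
    by (simp add: sets_PiM_single)
  show "sigma_sets UNIV ?E \<subseteq> sets (path_space :: (nat \<Rightarrow> 'a) measure)"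
  proof -
    have "?E \<subseteq> sets (path_space :: (nat \<Rightarrow> 'a) measure)" by auto
    from sets.sigma_sets_subset[OF this] show ?thesis by (simp add: space_PiM)
  qed
qed

lemma Int_stable_path_cylinders: "Int_stable (insert {} {path_cylinder n s | n s. True})"
proof -
  have *: "path_cylinder n s \<inter> path_cylinder m t \<in> {{}, path_cylinder m t}" if "n \<le> m" for n m s t
    using that by (auto simp: path_cylinder_def)
  have **: "path_cylinder n s \<inter> path_cylinder m t \<in> insert {} {path_cylinder n s | n s. True}"
    for n m s t
    using *[of n m s t] *[of m n t s] by (cases "n \<le> m") (auto simp: Int_commute)
  show ?thesis
  proof (rule Int_stableI)
    fix a b :: "(nat \<Rightarrow> 'a) set"
    assume "a \<in> insert {} {path_cylinder n s | n s. True}"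
      "b \<in> insert {} {path_cylinder n s | n s. True}"
    then consider "a = {} \<or> b = {}" | n s m t where "a = path_cylinder n s" "b = path_cylinder m t"
      by blast
    then show "a \<inter> b \<in> insert {} {path_cylinder n s | n s. True}"
    proof cases
      case (2 n s m t)
      then show ?thesis using **[of n s m t] by simp
    qed auto
  qed
qed

lemma measurable_chain_law_cong:
  fixes p :: "'a::countable \<Rightarrow> 'a \<Rightarrow> real"
  shows "measurable (chain_law p x) = measurable path_space"
  by (intro ext measurable_cong_sets sets_chain_law refl)

lemma space_chain_law [simp]: "space (chain_law p x) = UNIV" for p :: "'a::countable \<Rightarrow> 'a \<Rightarrow> real"
  using sets_eq_imp_space_eq[OF sets_chain_law[of p x]] by (simp add: space_PiM)

text \<open>
  The Markov property at time one, as an identity of laws: both sides give a cylinder the same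
  product of transition probabilities. Statements about later times follow from it by
  induction.
\<close>

lemma chain_law_first_step:
  fixes p :: "'a::countable \<Rightarrow> 'a \<Rightarrow> real"
  assumes p: "stochastic_matrix p"
  shows "chain_law p x =
    measure_pmf (embed_pmf (p x)) \<bind> (\<lambda>z. distr (chain_law p z) path_space (case_nat x))"
    (is "_ = ?N")
proof -
  define K where "K z = distr (chain_law p z) path_space (case_nat x)" for z
  have mcase [measurable]: "case_nat x \<in> chain_law p z \<rightarrow>\<^sub>M path_space" for z
    by (simp add: measurable_chain_law_cong)
  have K: "K \<in> measurable (measure_pmf (embed_pmf (p x))) (subprob_algebra path_space)"
  proof -
    have "prob_space (K z)" for z
      unfolding K_def by (rule prob_space.prob_space_distr[OF prob_space_chain_law mcase])
    then show ?thesis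
      by (auto simp: space_subprob_algebra K_def prob_space_imp_subprob_space)
  qed
  have sets_N: "sets (measure_pmf (embed_pmf (p x)) \<bind> K) = sets path_space"
    by (rule sets_bind[OF _ ]) (auto simp: K_def)
  have eq: "emeasure (chain_law p x) (path_cylinder n s) =
      emeasure (measure_pmf (embed_pmf (p x)) \<bind> K) (path_cylinder n s)" for n s
  proof -
    have "emeasure (measure_pmf (embed_pmf (p x)) \<bind> K) (path_cylinder n s) =
        (\<integral>\<^sup>+z. emeasure (K z) (path_cylinder n s) \<partial>measure_pmf (embed_pmf (p x)))"
      by (rule emeasure_bind[OF _ K]) auto
    also have "\<dots> = (\<integral>\<^sup>+z. emeasure (chain_law p z) {\<omega>. case_nat x \<omega> \<in> path_cylinder n s}
        \<partial>measure_pmf (embed_pmf (p x)))"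
      by (intro nn_integral_cong) (simp add: K_def emeasure_distr vimage_def)
    also have "\<dots> = emeasure (chain_law p x) (path_cylinder n s)"
    proof (cases n)
      case 0
      have "{\<omega>. case_nat x \<omega> \<in> path_cylinder n s} = (if s 0 = x then UNIV else {})"
        using 0 by (auto simp: path_cylinder_def)
      then show ?thesis
        using emeasure_chain_law_cylinder[OF p, of x 0 s] 0
          prob_space.emeasure_space_1[OF prob_space_chain_law[of p]]
        by (auto simp: path_cylinder_def)
    next
      case (Suc m)
      have "{\<omega>. case_nat x \<omega> \<in> path_cylinder n s} =
          (if s 0 = x then {\<omega>. \<forall>i\<le>m. \<omega> i = s (Suc i)} else {})"
        unfolding path_cylinder_def Suc less_Suc_eq_le[symmetric] mem_Collect_eq
        by (subst All_less_Suc2) auto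
      then have "(\<integral>\<^sup>+z. emeasure (chain_law p z) {\<omega>. case_nat x \<omega> \<in> path_cylinder n s}
            \<partial>measure_pmf (embed_pmf (p x))) =
          (\<integral>\<^sup>+z. (if s 0 = x then ennreal (\<Prod>i<m. p (s (Suc i)) (s (Suc (Suc i)))) else 0) *
             indicator {s 1} z \<partial>measure_pmf (embed_pmf (p x)))"
        using emeasure_chain_law_cylinder[OF p, of _ m "\<lambda>i. s (Suc i)"]
        by (intro nn_integral_cong) (auto simp: indicator_def)
      also have "\<dots> = (if s 0 = x then ennreal (\<Prod>i<m. p (s (Suc i)) (s (Suc (Suc i)))) else 0) *
          ennreal (p x (s 1))"
        by (simp add: nn_integral_cmult_indicator emeasure_pmf_single pmf_embed_stochastic[OF p])
      also have "\<dots> = emeasure (chain_law p x) (path_cylinder n s)"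
      proof -
        have "0 \<le> p a b" for a b using p by (auto simp: stochastic_matrix_def)
        then show ?thesis
          unfolding path_cylinder_def emeasure_chain_law_cylinder[OF p] Suc
          by (subst prod.lessThan_Suc_shift) (auto simp: ennreal_mult prod_nonneg mult.commute)
      qed
      finally show ?thesis .
    qed
    finally show ?thesis by simp
  qed
  have "chain_law p x = measure_pmf (embed_pmf (p x)) \<bind> K"
  proof (rule measure_eqI_generator_eq[OF Int_stable_path_cylinders, of UNIV])
    show "range (\<lambda>i. path_cylinder 0 (\<lambda>_. from_nat i)) \<subseteq> insert {} {path_cylinder n s | n (s :: nat \<Rightarrow> 'a). True}"
      by auto
    show "(\<Union>i. path_cylinder 0 (\<lambda>_. from_nat i)) = (UNIV :: (nat \<Rightarrow> 'a) set)"
      by (auto simp: path_cylinder_def) (metis from_nat_to_nat)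
    show "emeasure (chain_law p x) (path_cylinder 0 (\<lambda>_. from_nat i)) \<noteq> \<infinity>" for i
      using prob_space_chain_law[of p x]
      by (simp add: finite_measure.emeasure_finite prob_space_def)
  qed (use eq sets_N in \<open>auto simp: sets_chain_law sets_path_space\<close>)
  then show ?thesis by (simp add: K_def[abs_def])
qed

lemma nn_integral_chain_law_first_step:
  fixes p :: "'a::countable \<Rightarrow> 'a \<Rightarrow> real"
  assumes p: "stochastic_matrix p" and f [measurable]: "f \<in> borel_measurable path_space"
  shows "(\<integral>\<^sup>+\<omega>. f \<omega> \<partial>chain_law p x) =
    (\<integral>\<^sup>+z. ennreal (p x z) * (\<integral>\<^sup>+\<omega>. f (case_nat x \<omega>) \<partial>chain_law p z) \<partial>count_space UNIV)"
proof -
  have mcase [measurable]: "case_nat x \<in> chain_law p z \<rightarrow>\<^sub>M path_space" for z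
    by (simp add: measurable_chain_law_cong)
  have "prob_space (distr (chain_law p z) path_space (case_nat x))" for z
    by (rule prob_space.prob_space_distr[OF prob_space_chain_law mcase])
  then have K: "(\<lambda>z. distr (chain_law p z) path_space (case_nat x))
      \<in> measurable (measure_pmf (embed_pmf (p x))) (subprob_algebra path_space)"
    by (auto simp: space_subprob_algebra prob_space_imp_subprob_space)
  show ?thesis
    by (subst chain_law_first_step[OF p], subst nn_integral_bind[OF f K])
      (simp add: nn_integral_distr nn_integral_measure_pmf pmf_embed_stochastic[OF p])
qed

lemma emeasure_chain_law_first_step:
  fixes p :: "'a::countable \<Rightarrow> 'a \<Rightarrow> real"
  assumes p: "stochastic_matrix p" and A: "Measurable.pred path_space A"
  shows "emeasure (chain_law p x) {\<omega>. A \<omega>} =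
    (\<integral>\<^sup>+z. ennreal (p x z) * emeasure (chain_law p z) {\<omega>. A (case_nat x \<omega>)} \<partial>count_space UNIV)"
proof -
  have A': "{\<omega>. A \<omega>} \<in> sets path_space"
    using A by (simp add: pred_def space_PiM)
  have "Measurable.pred path_space (\<lambda>\<omega>. A (case_nat x \<omega>))"
    using A by measurable
  then have A'': "{\<omega>. A (case_nat x \<omega>)} \<in> sets path_space"
    by (simp add: pred_def space_PiM)
  have "emeasure (chain_law p x) {\<omega>. A \<omega>} = (\<integral>\<^sup>+\<omega>. indicator {\<omega>. A \<omega>} \<omega> \<partial>chain_law p x)"
    using A' by (simp add: sets_chain_law)
  also have "\<dots> = (\<integral>\<^sup>+z. ennreal (p x z) *
      (\<integral>\<^sup>+\<omega>. indicator {\<omega>. A \<omega>} (case_nat x \<omega>) \<partial>chain_law p z) \<partial>count_space UNIV)"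
    using A' by (intro nn_integral_chain_law_first_step[OF p]) auto
  also have "(\<lambda>\<omega>. indicator {\<omega>. A \<omega>} (case_nat x \<omega>) :: ennreal) = indicator {\<omega>. A (case_nat x \<omega>)}"
    by (auto simp: indicator_def)
  finally show ?thesis
    using A'' by (simp add: sets_chain_law)
qed

lemma AE_chain_law_start:
  fixes p :: "'a::countable \<Rightarrow> 'a \<Rightarrow> real"
  assumes p: "stochastic_matrix p"
  shows "AE \<omega> in chain_law p x. \<omega> 0 = x"
proof -
  interpret prob_space "chain_law p x" by (rule prob_space_chain_law)
  have "emeasure (chain_law p x) {\<omega>. \<omega> 0 = x} = 1"
    using emeasure_chain_law_cylinder[OF p, of x 0 "\<lambda>_. x"] by simp
  then show ?thesis
    using AE_prob_1[of "{\<omega>. \<omega> 0 = x}"] by (simp add: measure_def)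
qed

lemma AE_chain_law_first_step:
  fixes p :: "'a::countable \<Rightarrow> 'a \<Rightarrow> real"
  assumes p: "stochastic_matrix p" and A: "Measurable.pred path_space A"
    and step: "\<And>z. AE \<omega> in chain_law p z. A (case_nat x \<omega>)"
  shows "AE \<omega> in chain_law p x. A \<omega>"
proof -
  have mnot: "Measurable.pred path_space (\<lambda>\<omega>. \<not> A \<omega>)" using A by measurable
  have "Measurable.pred path_space (\<lambda>\<omega>. \<not> A (case_nat x \<omega>))" using A by measurable
  then have "emeasure (chain_law p z) {\<omega>. \<not> A (case_nat x \<omega>)} = 0" for z
    using step[of z] by (subst (asm) AE_iff_measurable[OF _ refl]) (auto simp: pred_def space_PiM sets_chain_law)
  then have "emeasure (chain_law p x) {\<omega>. \<not> A \<omega>} = 0"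
    by (subst emeasure_chain_law_first_step[OF p mnot]) simp
  then show ?thesis
    using mnot by (subst AE_iff_measurable[OF _ refl]) (auto simp: pred_def space_PiM sets_chain_law)
qed


section \<open>Paths avoiding a state\<close>

lemma nn_integral_count_space_swap:
  fixes f :: "'a \<Rightarrow> 'b \<Rightarrow> ennreal"
  shows "(\<integral>\<^sup>+x. \<integral>\<^sup>+y. f x y \<partial>count_space UNIV \<partial>count_space UNIV) =
    (\<integral>\<^sup>+y. \<integral>\<^sup>+x. f x y \<partial>count_space UNIV \<partial>count_space UNIV)"
  using nn_integral_fst_count_space[of "\<lambda>(x, y). f x y"] nn_integral_snd_count_space[of "\<lambda>(x, y). f x y"]
  by simp

text \<open>
  The weight of the paths of \<open>n + 1\<close> steps from \<open>x\<close> to \<open>z\<close> whose \<open>n\<close> intermediate states differ from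
  \<open>y\<close>. The endpoints are unrestricted, which makes the notion symmetric under time reversal.
\<close>

primrec taboo :: "('a \<Rightarrow> 'a \<Rightarrow> real) \<Rightarrow> 'a \<Rightarrow> nat \<Rightarrow> 'a \<Rightarrow> 'a \<Rightarrow> ennreal" where
  "taboo p y 0 x z = ennreal (p x z)"
| "taboo p y (Suc n) x z =
    (\<integral>\<^sup>+u. ennreal (p x u) * (indicator (-{y}) u * taboo p y n u z) \<partial>count_space UNIV)"

text \<open>
  Decomposition at the last step. Reversal exchanges it with the first-step decomposition in the
  definition.
\<close>

lemma taboo_Suc_right:
  "taboo p y (Suc n) x z =
    (\<integral>\<^sup>+u. taboo p y n x u * (indicator (-{y}) u * ennreal (p u z)) \<partial>count_space UNIV)"
proof (induction n arbitrary: x)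
  case (Suc n)
  have "taboo p y (Suc (Suc n)) x z =
      (\<integral>\<^sup>+u. \<integral>\<^sup>+v. ennreal (p x u) * (indicator (-{y}) u * taboo p y n u v) *
        (indicator (-{y}) v * ennreal (p v z)) \<partial>count_space UNIV \<partial>count_space UNIV)"
    by (subst taboo.simps(2)) (simp only: Suc.IH, simp add: nn_integral_cmult[symmetric] mult.assoc)
  also have "\<dots> = (\<integral>\<^sup>+v. \<integral>\<^sup>+u. ennreal (p x u) * (indicator (-{y}) u * taboo p y n u v) *
        (indicator (-{y}) v * ennreal (p v z)) \<partial>count_space UNIV \<partial>count_space UNIV)"
    by (rule nn_integral_count_space_swap)
  also have "\<dots> = (\<integral>\<^sup>+v. taboo p y (Suc n) x v * (indicator (-{y}) v * ennreal (p v z))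
      \<partial>count_space UNIV)"
    by (simp add: nn_integral_multc)
  finally show ?case .
qed simp

text \<open>
  A single step of the reversed chain from \<open>x\<close> to \<open>u\<close> satisfies \<open>\<pi>(x) p\<^sup>*(x, u) = \<pi>(u) p(u, x)\<close>; along a
  path these identities telescope.
\<close>

lemma taboo_reversed:
  assumes p: "stochastic_matrix p" and pos: "\<And>x. \<pi> x > 0"
  shows "ennreal (\<pi> x) * taboo (reversed p \<pi>) y n x z = ennreal (\<pi> z) * taboo p y n z x"
proof (induction n arbitrary: x)
  have nn: "0 \<le> p x y" for x y using p by (simp add: stochastic_matrix_def)
  have one: "ennreal (\<pi> x) * ennreal (reversed p \<pi> x u) = ennreal (\<pi> u) * ennreal (p u x)" for x u
    using pos[of x] pos[of u] nn[of u x] by (simp add: reversed_def flip: ennreal_mult)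
  {
    case 0
    show ?case by (simp add: one)
  next
    case (Suc n)
    have "ennreal (\<pi> x) * taboo (reversed p \<pi>) y (Suc n) x z =
        (\<integral>\<^sup>+u. (ennreal (\<pi> x) * ennreal (reversed p \<pi> x u)) *
          (indicator (-{y}) u * taboo (reversed p \<pi>) y n u z) \<partial>count_space UNIV)"
      by (simp add: nn_integral_cmult[symmetric] mult.assoc)
    also have "\<dots> = (\<integral>\<^sup>+u. (ennreal (\<pi> u) * taboo (reversed p \<pi>) y n u z) *
          (indicator (-{y}) u * ennreal (p u x)) \<partial>count_space UNIV)"
      by (simp add: one ac_simps)
    also have "\<dots> = ennreal (\<pi> z) * taboo p y (Suc n) z x"
      unfolding taboo_Suc_right by (simp add: Suc.IH nn_integral_cmult[symmetric] ac_simps)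
    finally show ?case .
  }
qed

lemma measurable_avoiding [measurable]:
  fixes y :: "'a::countable"
  shows "indicator {\<omega>. \<forall>i<n. \<omega> (Suc i) \<noteq> y} \<in> path_space \<rightarrow>\<^sub>M (borel :: ennreal measure)"
proof -
  have "{\<omega> \<in> space path_space. \<forall>i<n. \<omega> (Suc i) \<noteq> y} \<in> sets (path_space :: (nat \<Rightarrow> 'a) measure)"
    by measurable
  then show ?thesis by (simp add: space_PiM)
qed

text \<open>The bridge from path space to \<open>taboo\<close>: the probability of hitting \<open>y\<close>, the mean of \<open>H\<^sub>y\<close>
  and \<open>\<nu>\<close> are sums of such integrals.\<close>

lemma nn_integral_avoiding:
  fixes p :: "'a::countable \<Rightarrow> 'a \<Rightarrow> real" and f :: "'a \<Rightarrow> ennreal"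
  assumes p: "stochastic_matrix p"
  shows "(\<integral>\<^sup>+\<omega>. f (\<omega> (Suc n)) * indicator {\<omega>. \<forall>i<n. \<omega> (Suc i) \<noteq> y} \<omega> \<partial>chain_law p x) =
    (\<integral>\<^sup>+z. taboo p y n x z * f z \<partial>count_space UNIV)"
proof (induction n arbitrary: x)
  case 0
  have "(\<integral>\<^sup>+\<omega>. f (\<omega> 0) \<partial>chain_law p z) = f z" for z
  proof -
    have "(\<integral>\<^sup>+\<omega>. f (\<omega> 0) \<partial>chain_law p z) = (\<integral>\<^sup>+\<omega>. f z \<partial>chain_law p z)"
    proof (rule nn_integral_cong_AE)
      show "AE \<omega> in chain_law p z. f (\<omega> 0) = f z"
        using AE_chain_law_start[OF p, of z] by eventually_elim simp
    qed
    then show ?thesis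
      using prob_space.emeasure_space_1[OF prob_space_chain_law[of p z]] by simp
  qed
  then show ?case
    by (simp add: nn_integral_chain_law_first_step[OF p, of "\<lambda>\<omega>. f (\<omega> (Suc 0))"])
next
  case (Suc n)
  have inner: "(\<integral>\<^sup>+\<omega>. f (\<omega> (Suc n)) * indicator {\<omega>. \<forall>i<Suc n. \<omega> (Suc i) \<noteq> y} (case_nat x \<omega>) \<partial>chain_law p u) =
      indicator (-{y}) u * (\<integral>\<^sup>+z. taboo p y n u z * f z \<partial>count_space UNIV)" for u
  proof -
    have "(\<integral>\<^sup>+\<omega>. f (\<omega> (Suc n)) * indicator {\<omega>. \<forall>i<Suc n. \<omega> (Suc i) \<noteq> y} (case_nat x \<omega>) \<partial>chain_law p u) =
        (\<integral>\<^sup>+\<omega>. indicator (-{y}) u * (f (\<omega> (Suc n)) * indicator {\<omega>. \<forall>i<n. \<omega> (Suc i) \<noteq> y} \<omega>) \<partial>chain_law p u)"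
    proof (rule nn_integral_cong_AE)
      have *: "(\<forall>i<Suc n. \<omega> i \<noteq> y) \<longleftrightarrow> \<omega> 0 \<noteq> y \<and> (\<forall>i<n. \<omega> (Suc i) \<noteq> y)" for \<omega>
        by (rule All_less_Suc2)
      show "AE \<omega> in chain_law p u.
          f (\<omega> (Suc n)) * indicator {\<omega>. \<forall>i<Suc n. \<omega> (Suc i) \<noteq> y} (case_nat x \<omega>) =
          indicator (-{y}) u * (f (\<omega> (Suc n)) * indicator {\<omega>. \<forall>i<n. \<omega> (Suc i) \<noteq> y} \<omega>)"
        using AE_chain_law_start[OF p, of u]
        by eventually_elim (auto simp: indicator_def *)
    qed
    also have "\<dots> = indicator (-{y}) u * (\<integral>\<^sup>+z. taboo p y n u z * f z \<partial>count_space UNIV)"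
      by (subst nn_integral_cmult) (simp_all add: Suc.IH measurable_chain_law_cong)
    finally show ?thesis .
  qed
  have "(\<integral>\<^sup>+\<omega>. f (\<omega> (Suc (Suc n))) * indicator {\<omega>. \<forall>i<Suc n. \<omega> (Suc i) \<noteq> y} \<omega> \<partial>chain_law p x) =
      (\<integral>\<^sup>+u. \<integral>\<^sup>+z. ennreal (p x u) * (indicator (-{y}) u * taboo p y n u z) * f z
        \<partial>count_space UNIV \<partial>count_space UNIV)"
    by (subst nn_integral_chain_law_first_step[OF p])
      (simp_all add: inner nn_integral_cmult[symmetric] mult.assoc)
  also have "\<dots> = (\<integral>\<^sup>+z. \<integral>\<^sup>+u. ennreal (p x u) * (indicator (-{y}) u * taboo p y n u z) * f z
        \<partial>count_space UNIV \<partial>count_space UNIV)"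
    by (rule nn_integral_count_space_swap)
  also have "\<dots> = (\<integral>\<^sup>+z. taboo p y (Suc n) x z * f z \<partial>count_space UNIV)"
    by (simp add: nn_integral_multc)
  finally show ?case .
qed

lemma less_hitting_time_iff: "enat n < hitting_time y \<omega> \<longleftrightarrow> (\<forall>i<n. \<omega> (Suc i) \<noteq> y)"
proof -
  have "enat (Suc n) \<le> hitting_time y \<omega> \<longleftrightarrow> (\<forall>m. m > 0 \<and> \<omega> m = y \<longrightarrow> Suc n \<le> m)"
    by (auto simp: hitting_time_def le_Inf_iff)
  also have "\<dots> \<longleftrightarrow> (\<forall>i<n. \<omega> (Suc i) \<noteq> y)"
    by (metis Suc_le_mono gr0_conv_Suc linorder_not_le less_eq_Suc_le)
  finally show ?thesis by (simp add: Suc_ile_eq)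
qed

lemma hitting_time_finite_iff: "hitting_time y \<omega> < \<infinity> \<longleftrightarrow> (\<exists>n. \<omega> (Suc n) = y)"
proof -
  have "hitting_time y \<omega> = \<infinity> \<longleftrightarrow> (\<forall>n. enat n < hitting_time y \<omega>)"
    by (metis enat_ord_simps(4) less_irrefl not_infinity_eq)
  then show ?thesis by (auto simp: less_hitting_time_iff)
qed

lemma ennreal_of_enat_eq_suminf: "ennreal_of_enat k = (\<Sum>n. if enat n < k then 1 else 0)"
proof (cases k)
  case (enat m)
  have "(\<Sum>n. if enat n < k then 1 else 0 :: ennreal) = (\<Sum>n\<in>{..<m}. if enat n < k then 1 else 0)"
    using enat by (intro suminf_finite) auto
  then show ?thesis using enat by simp
next
  case infinity
  have "(\<Sum>n::nat. 1 :: ennreal) = \<infinity>"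
    using nn_integral_count_space_nat[of "\<lambda>_. 1"] by simp
  then show ?thesis using infinity by simp
qed

lemma suminf_first_time:
  "(\<Sum>n. if P n \<and> (\<forall>i<n. \<not> P i) then 1 else 0 :: ennreal) = (if \<exists>n. P n then 1 else 0)"
proof (cases "\<exists>n. P n")
  case True
  define m where "m = (LEAST n. P n)"
  have "P m" "\<And>i. i < m \<Longrightarrow> \<not> P i"
    using True LeastI_ex not_less_Least unfolding m_def by blast+
  then have "P n \<and> (\<forall>i<n. \<not> P i) \<longleftrightarrow> n = m" for n
    by (metis linorder_neqE_nat)
  then show ?thesis using True
    by (subst suminf_finite[of "{m}"]) auto
qed simp

text \<open>
  The Green function of the chain killed at its first hitting of \<open>y\<close>: the expected number of visits
  to \<open>z\<close> at the times \<open>1, \<dots>, H\<^sub>y\<close>. The time \<open>H\<^sub>y\<close> itself is included, so that the value at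
  \<open>z = y\<close> is the probability of hitting \<open>y\<close>.
\<close>

definition green :: "('a \<Rightarrow> 'a \<Rightarrow> real) \<Rightarrow> 'a \<Rightarrow> 'a \<Rightarrow> 'a \<Rightarrow> ennreal" where
  "green p y x z = (\<Sum>n. taboo p y n x z)"

lemma green_first_step:
  "green p y x z = ennreal (p x z) +
    (\<integral>\<^sup>+u. ennreal (p x u) * (indicator (-{y}) u * green p y u z) \<partial>count_space UNIV)"
proof -
  have "green p y x z = taboo p y 0 x z + (\<Sum>n. taboo p y (Suc n) x z)"
    unfolding green_def by (subst suminf_offset[of _ 1]) simp_all
  then show ?thesis
    by (simp add: green_def nn_integral_suminf[symmetric])
qed

lemma green_last_step:
  "green p y x z = ennreal (p x z) +
    (\<integral>\<^sup>+u. green p y x u * (indicator (-{y}) u * ennreal (p u z)) \<partial>count_space UNIV)"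
proof -
  have "green p y x z = taboo p y 0 x z + (\<Sum>n. taboo p y (Suc n) x z)"
    unfolding green_def by (subst suminf_offset[of _ 1]) simp_all
  then show ?thesis unfolding taboo_Suc_right
    by (simp add: green_def nn_integral_suminf[symmetric])
qed

lemma sets_hitting_time_finite:
  fixes p :: "'a::countable \<Rightarrow> 'a \<Rightarrow> real"
  shows "{\<omega>. hitting_time y \<omega> < \<infinity>} \<in> sets (chain_law p x)"
proof -
  have "{\<omega> \<in> space path_space. \<exists>n. \<omega> (Suc n) = y} \<in> sets (path_space :: (nat \<Rightarrow> 'a) measure)"
    by measurable
  then show ?thesis
    unfolding hitting_time_finite_iff by (simp add: space_PiM sets_chain_law)
qed

text \<open>On the event of hitting \<open>y\<close> there is exactly one first hitting time.\<close>

lemma emeasure_hitting_time_finite: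
  fixes p :: "'a::countable \<Rightarrow> 'a \<Rightarrow> real"
  assumes p: "stochastic_matrix p"
  shows "emeasure (chain_law p x) {\<omega>. hitting_time y \<omega> < \<infinity>} = green p y x y"
proof -
  have "emeasure (chain_law p x) {\<omega>. hitting_time y \<omega> < \<infinity>} =
      (\<integral>\<^sup>+\<omega>. indicator {\<omega>. \<exists>n. \<omega> (Suc n) = y} \<omega> \<partial>chain_law p x)"
    using sets_hitting_time_finite[of y p x] unfolding hitting_time_finite_iff by simp
  also have "\<dots> = (\<integral>\<^sup>+\<omega>. (\<Sum>n. indicator {y} (\<omega> (Suc n)) *
      indicator {\<omega>. \<forall>i<n. \<omega> (Suc i) \<noteq> y} \<omega>) \<partial>chain_law p x)"
  proof (rule nn_integral_cong)
    fix \<omega> :: "nat \<Rightarrow> 'a"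
    have "indicator {y} (\<omega> (Suc n)) * indicator {\<omega>. \<forall>i<n. \<omega> (Suc i) \<noteq> y} \<omega> =
        (if \<omega> (Suc n) = y \<and> (\<forall>i<n. \<omega> (Suc i) \<noteq> y) then 1 else 0 :: ennreal)" for n
      by (auto simp: indicator_def)
    then show "indicator {\<omega>. \<exists>n. \<omega> (Suc n) = y} \<omega> = (\<Sum>n. indicator {y} (\<omega> (Suc n)) *
        indicator {\<omega>. \<forall>i<n. \<omega> (Suc i) \<noteq> y} \<omega> :: ennreal)"
      using suminf_first_time[of "\<lambda>n. \<omega> (Suc n) = y"] by (simp add: indicator_def of_bool_def)
  qed
  also have "\<dots> = (\<Sum>n. \<integral>\<^sup>+\<omega>. indicator {y} (\<omega> (Suc n)) *
      indicator {\<omega>. \<forall>i<n. \<omega> (Suc i) \<noteq> y} \<omega> \<partial>chain_law p x)"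
    by (rule nn_integral_suminf) (simp add: measurable_chain_law_cong)
  also have "\<dots> = green p y x y"
    by (simp only: nn_integral_avoiding[OF p, where f = "indicator {y}"]) (simp add: green_def)
  finally show ?thesis .
qed

lemma ennreal_of_enat_hitting_time:
  "ennreal_of_enat (hitting_time y \<omega>) = (\<Sum>n. indicator {\<omega>. \<forall>i<n. \<omega> (Suc i) \<noteq> y} \<omega>)"
  by (simp add: ennreal_of_enat_eq_suminf less_hitting_time_iff indicator_def of_bool_def)

lemma measurable_hitting_time [measurable]:
  fixes y :: "'a::countable"
  shows "(\<lambda>\<omega>. ennreal_of_enat (hitting_time y \<omega>)) \<in> borel_measurable path_space"
  unfolding ennreal_of_enat_hitting_time by measurable

text \<open>\<open>H\<^sub>y\<close> counts the times \<open>1, \<dots>, H\<^sub>y\<close>, and at each of them the chain is in exactly one state.\<close>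

lemma nn_integral_hitting_time:
  fixes p :: "'a::countable \<Rightarrow> 'a \<Rightarrow> real"
  assumes p: "stochastic_matrix p"
  shows "(\<integral>\<^sup>+\<omega>. ennreal_of_enat (hitting_time y \<omega>) \<partial>chain_law p x) =
    (\<integral>\<^sup>+z. green p y x z \<partial>count_space UNIV)"
proof -
  have "(\<integral>\<^sup>+\<omega>. ennreal_of_enat (hitting_time y \<omega>) \<partial>chain_law p x) =
      (\<Sum>n. \<integral>\<^sup>+\<omega>. indicator {\<omega>. \<forall>i<n. \<omega> (Suc i) \<noteq> y} \<omega> \<partial>chain_law p x)"
    unfolding ennreal_of_enat_hitting_time by (rule nn_integral_suminf, simp add: measurable_chain_law_cong)
  also have "\<dots> = (\<Sum>n. \<integral>\<^sup>+z. taboo p y n x z \<partial>count_space UNIV)"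
    using nn_integral_avoiding[OF p, where f = "\<lambda>_. 1"] by simp
  also have "\<dots> = (\<integral>\<^sup>+z. green p y x z \<partial>count_space UNIV)"
    by (simp add: green_def nn_integral_suminf)
  finally show ?thesis .
qed

text \<open>
  The sum over \<open>n\<close> inside the expectation becomes a sum over reversed paths of all lengths; reading them
  backwards replaces the start \<open>x\<close> by the end \<open>x\<close> and removes the reversed chain from the formula.
\<close>

lemma cat_mouse_measure_eq_green:
  fixes p :: "'a::countable \<Rightarrow> 'a \<Rightarrow> real"
  assumes p: "stochastic_matrix p" and pos: "\<And>x. \<pi> x > 0"
    and inv: "invariant_measure p (\<lambda>x. ennreal (\<pi> x))"
  shows "cat_mouse_measure p \<pi> x y =
    (\<integral>\<^sup>+z. ennreal (\<pi> z) * ennreal (p z y) * green p y z x \<partial>count_space UNIV)"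
proof -
  have r: "stochastic_matrix (reversed p \<pi>)"
    by (rule stochastic_reversed[OF p pos inv])
  have "(\<integral>\<^sup>+n. ennreal (p (\<omega> n) y) \<partial>count_space {n. 1 \<le> n \<and> enat n \<le> hitting_time y \<omega>}) =
      (\<Sum>n. ennreal (p (\<omega> (Suc n)) y) * indicator {\<omega>. \<forall>i<n. \<omega> (Suc i) \<noteq> y} \<omega>)" for \<omega>
  proof -
    \<comment> \<open>Time \<open>n + 1\<close> is within the range of summation iff the times \<open>1, \<dots>, n\<close> avoid \<open>y\<close>.\<close>
    have "{n. 1 \<le> n \<and> enat n \<le> hitting_time y \<omega>} = Suc ` {n. enat n < hitting_time y \<omega>}" (is "?A = Suc ` ?B")
    proof (intro set_eqI iffI)
      fix n assume "n \<in> ?A"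
      then show "n \<in> Suc ` ?B" by (cases n) (auto simp: Suc_ile_eq)
    qed (auto simp: Suc_ile_eq)
    then have "(\<integral>\<^sup>+n. ennreal (p (\<omega> n) y) \<partial>count_space ?A) =
        (\<integral>\<^sup>+n. ennreal (p (\<omega> (Suc n)) y) \<partial>count_space ?B)"
      using nn_integral_bij_count_space[of Suc ?B ?A "\<lambda>n. ennreal (p (\<omega> n) y)"]
      by (simp add: bij_betw_def)
    also have "\<dots> = (\<integral>\<^sup>+n. ennreal (p (\<omega> (Suc n)) y) * indicator ?B n \<partial>count_space UNIV)"
      by (rule nn_integral_count_space_indicator) simp
    finally show ?thesis
      by (simp add: nn_integral_count_space_nat less_hitting_time_iff indicator_def)
  qed
  then have "cat_mouse_measure p \<pi> x y = ennreal (\<pi> x) *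
      (\<Sum>n. \<integral>\<^sup>+\<omega>. ennreal (p (\<omega> (Suc n)) y) * indicator {\<omega>. \<forall>i<n. \<omega> (Suc i) \<noteq> y} \<omega>
        \<partial>chain_law (reversed p \<pi>) x)"
    unfolding cat_mouse_measure_def
    by (simp only:) (subst nn_integral_suminf, simp_all add: measurable_chain_law_cong)
  also have "\<dots> = (\<Sum>n. \<integral>\<^sup>+z. (ennreal (\<pi> x) * taboo (reversed p \<pi>) y n x z) * ennreal (p z y) \<partial>count_space UNIV)"
    by (simp only: nn_integral_avoiding[OF r, where f = "\<lambda>z. ennreal (p z y)"])
      (simp add: nn_integral_cmult[symmetric] mult.assoc flip: ennreal_suminf_cmult)
  also have "\<dots> = (\<integral>\<^sup>+z. ennreal (\<pi> z) * ennreal (p z y) * green p y z x \<partial>count_space UNIV)"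
  proof -
    have *: "(\<Sum>n. ennreal (\<pi> z) * taboo p y n z x * ennreal (p z y)) =
        ennreal (\<pi> z) * ennreal (p z y) * green p y z x" for z
      unfolding green_def by (subst ennreal_suminf_cmult[symmetric]) (simp only: ac_simps)
    show ?thesis
      unfolding taboo_reversed[of p \<pi>, OF p pos] *[symmetric]
      by (rule nn_integral_suminf[symmetric]) simp
  qed
  finally show ?thesis .
qed

section \<open>Hitting probabilities and superharmonic functions\<close>

text \<open>
  The form in which irreducibility is used: a property that holds at one state and is inherited by
  predecessors holds everywhere, since each state leads to the given one.
\<close>

lemma irreducible_chain_predecessor_closed:
  fixes p :: "'a::countable \<Rightarrow> 'a \<Rightarrow> real"
  assumes p: "stochastic_matrix p" and irr: "irreducible_chain p"
    and "y \<in> F" and pred: "\<And>x z. p x z > 0 \<Longrightarrow> z \<in> F \<Longrightarrow> x \<in> F"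
  shows "x \<in> F"
proof -
  have *: "x \<in> F" if "emeasure (chain_law p x) {\<omega>. \<omega> n = y} \<noteq> 0" for n x
    using that
  proof (induction n arbitrary: x)
    case 0
    have "emeasure (chain_law p x) {\<omega>. \<omega> 0 = y} = (if y = x then 1 else 0)"
      using emeasure_chain_law_cylinder[OF p, of x 0 "\<lambda>_. y"] by simp
    then show ?case using 0 \<open>y \<in> F\<close> by (auto split: if_splits)
  next
    case (Suc n)
    have "Measurable.pred path_space (\<lambda>\<omega>. \<omega> (Suc n) = y)" by measurable
    from emeasure_chain_law_first_step[OF p this, of x]
    have "(\<integral>\<^sup>+z. ennreal (p x z) * emeasure (chain_law p z) {\<omega>. \<omega> n = y} \<partial>count_space UNIV) \<noteq> 0"
      using Suc.prems by simp
    then obtain z where "ennreal (p x z) * emeasure (chain_law p z) {\<omega>. \<omega> n = y} \<noteq> 0"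
      by (auto simp: nn_integral_0_iff_AE AE_count_space)
    then show ?case
      using Suc.IH[of z] pred[of x z] by (auto simp: ennreal_eq_0_iff not_le)
  qed
  obtain n where "\<P>(\<omega> in chain_law p x. \<omega> n = y) > 0"
    using irr by (auto simp: irreducible_chain_def)
  then have "emeasure (chain_law p x) {\<omega>. \<omega> n = y} \<noteq> 0"
    by (auto simp: measure_def)
  then show ?thesis by (rule * )
qed

lemma green_le_1:
  fixes p :: "'a::countable \<Rightarrow> 'a \<Rightarrow> real"
  assumes p: "stochastic_matrix p"
  shows "green p y x y \<le> 1"
  unfolding emeasure_hitting_time_finite[OF p, symmetric]
  by (rule prob_space.emeasure_le_1[OF prob_space_chain_law])

text \<open>
  Recurrence is a statement about returns to the starting point. It makes the probability of hitting
  \<open>y\<close> harmonic everywhere, including at \<open>y\<close>, where it attains its maximum \<open>1\<close>; by the maximum principle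
  a state where it is \<open>1\<close> has only successors where it is \<open>1\<close>.
\<close>

lemma recurrent_green_eq_1:
  fixes p :: "'a::countable \<Rightarrow> 'a \<Rightarrow> real"
  assumes p: "stochastic_matrix p" and irr: "irreducible_chain p" and rec: "recurrent_chain p"
  shows "green p y x y = 1"
proof -
  have start: "green p y y y = 1"
  proof -
    interpret prob_space "chain_law p y" by (rule prob_space_chain_law)
    have "AE \<omega> in chain_law p y. hitting_time y \<omega> < \<infinity>"
      using rec by (simp add: recurrent_chain_def)
    then show ?thesis
      unfolding emeasure_hitting_time_finite[OF p, symmetric]
      using sets_hitting_time_finite[of y p y]
      by (subst (asm) AE_iff_emeasure_eq_1) (simp_all add: pred_def)
  qed
  have harm: "(\<integral>\<^sup>+u. ennreal (p x u) * green p y u y \<partial>count_space UNIV) = green p y x y" for x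
  proof -
    have "(\<integral>\<^sup>+u. ennreal (p x u) * green p y u y \<partial>count_space UNIV) =
        (\<integral>\<^sup>+u. ennreal (p x u) * indicator {y} u + ennreal (p x u) * (indicator (-{y}) u * green p y u y)
          \<partial>count_space UNIV)"
      by (intro nn_integral_cong) (auto simp: indicator_def start)
    also have "\<dots> = green p y x y"
      by (subst green_first_step) (simp add: nn_integral_add)
    finally show ?thesis .
  qed
  show ?thesis
  proof (rule ccontr)
    assume "green p y x y \<noteq> 1"
    have "y \<in> {x. green p y x y \<noteq> 1}"
    proof (rule irreducible_chain_predecessor_closed[OF p irr, of x])
      show "x \<in> {x. green p y x y \<noteq> 1}" using \<open>green p y x y \<noteq> 1\<close> by simp
      fix x z assume *: "p x z > 0" "z \<in> {x. green p y x y \<noteq> 1}"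
      \<comment> \<open>One successor with a value below \<open>1\<close> brings the average over all successors below \<open>1\<close>.\<close>
      have less: "ennreal (p x z) * green p y z y < ennreal (p x z)"
        using * green_le_1[OF p, of y z] ennreal_mult_strict_left_mono[of "green p y z y" 1 "ennreal (p x z)"]
        by (simp add: less_le)
      have le: "ennreal (p x u) * green p y u y \<le> ennreal (p x u)" for u
        using green_le_1[OF p, of y u] mult_left_mono[of "green p y u y" 1 "ennreal (p x u)"] by simp
      have "(\<integral>\<^sup>+u. ennreal (p x u) * green p y u y \<partial>count_space UNIV) <
          (\<integral>\<^sup>+u. ennreal (p x u) \<partial>count_space UNIV)"
      proof (rule nn_integral_less)
        show "(\<integral>\<^sup>+u. ennreal (p x u) * green p y u y \<partial>count_space UNIV) \<noteq> \<infinity>"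
          using green_le_1[OF p, of y x] harm[of x] by (metis ennreal_one_neq_top infinity_ennreal_def top_unique)
        show "\<not> (AE u in count_space UNIV. ennreal (p x u) \<le> ennreal (p x u) * green p y u y)"
          using less by (auto simp: AE_count_space not_le)
      qed (use le in auto)
      then show "x \<in> {x. green p y x y \<noteq> 1}"
        using p by (auto simp: harm stochastic_matrix_def)
    qed
    then show False using start by simp
  qed
qed

text \<open>
  Optional stopping at the hitting time of \<open>y\<close> for the supermartingale \<open>u(C\<^sub>n)\<close>. The induction on the
  time horizon only follows the paths that have hit \<open>y\<close> by then, which is enough as \<open>u \<ge> 0\<close>.
\<close>

lemma superharmonic_green_le:
  assumes super: "\<And>x. x \<noteq> y \<Longrightarrow> (\<integral>\<^sup>+z. ennreal (p x z) * u z \<partial>count_space UNIV) \<le> u x"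
    and "x \<noteq> y"
  shows "green p y x y * u y \<le> u x"
proof -
  have partial: "(\<Sum>n<N. taboo p y n x y) * u y \<le> u x" if "x \<noteq> y" for N x
    using that
  proof (induction N arbitrary: x)
    case (Suc N)
    have "(\<Sum>n<N. taboo p y (Suc n) x y) =
        (\<integral>\<^sup>+v. (\<Sum>n<N. ennreal (p x v) * (indicator (-{y}) v * taboo p y n v y)) \<partial>count_space UNIV)"
      by (simp add: nn_integral_sum)
    then have tail: "(\<Sum>n<N. taboo p y (Suc n) x y) =
        (\<integral>\<^sup>+v. ennreal (p x v) * (indicator (-{y}) v * (\<Sum>n<N. taboo p y n v y)) \<partial>count_space UNIV)"
      by (simp only: sum_distrib_left)
    have "(\<Sum>n<Suc N. taboo p y n x y) * u y =
        (\<integral>\<^sup>+v. ennreal (p x v) * indicator {y} v * u y +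
          ennreal (p x v) * (indicator (-{y}) v * (\<Sum>n<N. taboo p y n v y)) * u y \<partial>count_space UNIV)"
      by (subst sum.lessThan_Suc_shift, subst tail)
        (simp only: taboo.simps(1) distrib_right nn_integral_add nn_integral_multc
          borel_measurable_count_space nn_integral_cmult_indicator, simp)
    also have "\<dots> \<le> (\<integral>\<^sup>+v. ennreal (p x v) * u v \<partial>count_space UNIV)"
      using Suc.IH by (intro nn_integral_mono) (auto simp: indicator_def mult.assoc intro!: mult_left_mono)
    also have "\<dots> \<le> u x" using super Suc.prems by simp
    finally show ?case .
  qed simp
  have "green p y x y * u y = (\<Sum>n. taboo p y n x y * u y)"
    by (simp add: green_def)
  also have "\<dots> \<le> u x"
    using partial[OF \<open>x \<noteq> y\<close>] by (intro suminf_le_const summableI) (simp add: sum_distrib_right)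
  finally show ?thesis .
qed

text \<open>Time \<open>0\<close> counts here, in contrast to \<open>hitting_time\<close>: the value at \<open>e\<close> is \<open>1\<close>, and elsewhere
  the function is harmonic.\<close>

definition hit_prob :: "('a \<Rightarrow> 'a \<Rightarrow> real) \<Rightarrow> 'a \<Rightarrow> 'a \<Rightarrow> ennreal" where
  "hit_prob q e s = emeasure (chain_law q s) {\<omega>. \<exists>n. \<omega> n = e}"

lemma ex_case_nat: "(\<exists>n. P (case_nat s \<omega> n)) \<longleftrightarrow> P s \<or> (\<exists>n. P (\<omega> n))"
proof -
  have "(\<exists>n. Q n) \<longleftrightarrow> Q 0 \<or> (\<exists>n. Q (Suc n))" for Q
    by (metis not0_implies_Suc)
  from this[of "\<lambda>n. P (case_nat s \<omega> n)"] show ?thesis by simp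
qed

lemma hit_prob_eq:
  fixes q :: "'a::countable \<Rightarrow> 'a \<Rightarrow> real"
  assumes q: "stochastic_matrix q"
  shows "hit_prob q e s =
    (if s = e then 1 else (\<integral>\<^sup>+z. ennreal (q s z) * hit_prob q e z \<partial>count_space UNIV))"
proof -
  have *: "{\<omega>. \<exists>n. case_nat s \<omega> n = e} = (if s = e then UNIV else {\<omega>. \<exists>n. \<omega> n = e})"
    using ex_case_nat[of "\<lambda>z. z = e" s] by auto
  have "Measurable.pred path_space (\<lambda>\<omega>. \<exists>n. \<omega> n = e)" by measurable
  from emeasure_chain_law_first_step[OF q this, of s]
  show ?thesis
    using q prob_space.emeasure_space_1[OF prob_space_chain_law[of q]]
    by (simp add: hit_prob_def * stochastic_matrix_def)
qed

lemma hit_prob_superharmonic: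
  fixes q :: "'a::countable \<Rightarrow> 'a \<Rightarrow> real"
  assumes q: "stochastic_matrix q"
  shows "(\<integral>\<^sup>+z. ennreal (q s z) * hit_prob q e z \<partial>count_space UNIV) \<le> hit_prob q e s"
proof (cases "s = e")
  case True
  have "hit_prob q e z \<le> 1" for z
    unfolding hit_prob_def by (rule prob_space.emeasure_le_1[OF prob_space_chain_law])
  then have "(\<integral>\<^sup>+z. ennreal (q s z) * hit_prob q e z \<partial>count_space UNIV) \<le>
      (\<integral>\<^sup>+z. ennreal (q s z) * 1 \<partial>count_space UNIV)"
    by (intro nn_integral_mono mult_left_mono) auto
  then show ?thesis
    using True q hit_prob_eq[OF q, of e e] by (simp add: stochastic_matrix_def)
qed (simp add: hit_prob_eq[OF q, of e s])

lemma hit_prob_pos_step: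
  fixes q :: "'a::countable \<Rightarrow> 'a \<Rightarrow> real"
  assumes q: "stochastic_matrix q" and "q s z > 0" "hit_prob q e z \<noteq> 0"
  shows "hit_prob q e s \<noteq> 0"
proof
  assume "hit_prob q e s = 0"
  with hit_prob_superharmonic[OF q, where s = s and e = e]
  have "(\<integral>\<^sup>+z. ennreal (q s z) * hit_prob q e z \<partial>count_space UNIV) = 0" by simp
  then have "ennreal (q s z) * hit_prob q e z = 0"
    by (simp add: nn_integral_0_iff_AE AE_count_space)
  with assms(2,3) show False by simp
qed

text \<open>
  Missing \<open>e\<close> forever requires missing it during the first \<open>n\<close> steps and then missing it again from
  wherever the chain is, which has probability at most \<open>1 - c\<close>. For \<open>n \<rightarrow> \<infinity>\<close> this says that the
  probability \<open>f\<close> of missing \<open>e\<close> satisfies \<open>f \<le> (1 - c) f\<close>.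
\<close>

lemma AE_hit_of_hit_prob_bounded_below:
  fixes q :: "'a::countable \<Rightarrow> 'a \<Rightarrow> real"
  assumes q: "stochastic_matrix q" and "c > 0" and c: "\<And>s. c \<le> hit_prob q e s"
  shows "AE \<omega> in chain_law q s. \<exists>n. \<omega> n = e"
proof -
  define f where "f s = emeasure (chain_law q s) {\<omega>. \<forall>n. \<omega> n \<noteq> e}" for s
  define a where "a n s = emeasure (chain_law q s) {\<omega>. \<forall>i<n. \<omega> i \<noteq> e}" for n s
  have pred_f: "Measurable.pred path_space (\<lambda>\<omega>. \<forall>n. \<omega> n \<noteq> e)" by measurable
  have pred_a: "Measurable.pred path_space (\<lambda>\<omega>. \<forall>i<n. \<omega> i \<noteq> e)" for n by measurable
  have sets_f: "{\<omega>. \<forall>n. \<omega> n \<noteq> e} \<in> sets (chain_law q s)" for s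
    using pred_f by (simp add: pred_def space_PiM sets_chain_law)
  have sets_a: "{\<omega>. \<forall>i<n. \<omega> i \<noteq> e} \<in> sets (chain_law q s)" for n s
    using pred_a by (simp add: pred_def space_PiM sets_chain_law)
  have f_step: "f s = (if s = e then 0 else (\<integral>\<^sup>+z. ennreal (q s z) * f z \<partial>count_space UNIV))" for s
  proof -
    have *: "{\<omega>. \<forall>n. case_nat s \<omega> n \<noteq> e} = (if s = e then {} else {\<omega>. \<forall>n. \<omega> n \<noteq> e})"
      using ex_case_nat[of "\<lambda>z. z = e" s] by auto
    show ?thesis
      unfolding f_def emeasure_chain_law_first_step[OF q pred_f, of s] by (simp add: *)
  qed
  have a_step: "a (Suc n) s = (if s = e then 0 else (\<integral>\<^sup>+z. ennreal (q s z) * a n z \<partial>count_space UNIV))" for n s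
  proof -
    have *: "{\<omega>. \<forall>i<Suc n. case_nat s \<omega> i \<noteq> e} = (if s = e then {} else {\<omega>. \<forall>i<n. \<omega> i \<noteq> e})"
      unfolding All_less_Suc2 by auto
    show ?thesis
      unfolding a_def emeasure_chain_law_first_step[OF q pred_a, where x = s] by (simp add: *)
  qed
  define b where "b = 1 - c"
  have b: "b < 1" unfolding b_def using \<open>c > 0\<close>
    by (intro ennreal_between) auto
  have f_le: "f s \<le> b" for s
  proof -
    interpret prob_space "chain_law q s" by (rule prob_space_chain_law)
    have "{\<omega>. \<exists>n. \<omega> n = e} = space (chain_law q s) - {\<omega>. \<forall>n. \<omega> n \<noteq> e}" by auto
    then have "{\<omega>. \<exists>n. \<omega> n = e} \<in> events" using sets_f[of s] sets.compl_sets by metis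
    from emeasure_compl[OF this] have "f s = 1 - hit_prob q e s"
      using emeasure_space_1 by (simp add: f_def hit_prob_def Compl_eq_Diff_UNIV[symmetric] Collect_neg_eq[symmetric])
    then show ?thesis unfolding b_def using c[of s] by (simp add: ennreal_mono_minus)
  qed
  have f_le_a: "f s \<le> b * a n s" for n s
  proof (induction n arbitrary: s)
    case 0
    show ?case
      using f_le prob_space.emeasure_space_1[OF prob_space_chain_law[of q s]] by (simp add: a_def)
  next
    case (Suc n)
    have "(\<integral>\<^sup>+z. ennreal (q s z) * f z \<partial>count_space UNIV) \<le>
        (\<integral>\<^sup>+z. b * (ennreal (q s z) * a n z) \<partial>count_space UNIV)"
    proof (rule nn_integral_mono)
      fix z
      have "ennreal (q s z) * f z \<le> ennreal (q s z) * (b * a n z)"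
        by (rule mult_left_mono[OF Suc.IH]) simp
      then show "ennreal (q s z) * f z \<le> b * (ennreal (q s z) * a n z)"
        by (simp only: mult.left_commute)
    qed
    then show ?case
      by (subst f_step) (simp add: a_step nn_integral_cmult)
  qed
  have "f s = 0"
  proof -
    interpret prob_space "chain_law q s" by (rule prob_space_chain_law)
    have "(\<lambda>n. a n s) \<longlonglongrightarrow> emeasure (chain_law q s) (\<Inter>n. {\<omega>. \<forall>i<n. \<omega> i \<noteq> e})"
    proof -
      have "decseq (\<lambda>n. {\<omega>. \<forall>i<n. \<omega> i \<noteq> e})"
        unfolding decseq_def using order.strict_trans2 by blast
      then show ?thesis
        unfolding a_def using sets_a by (intro Lim_emeasure_decseq) auto
    qed
    also have "(\<Inter>n::nat. {\<omega>. \<forall>i<n. \<omega> i \<noteq> e}) = {\<omega>. \<forall>n. \<omega> n \<noteq> e}" by auto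
    finally have "(\<lambda>n. b * a n s) \<longlonglongrightarrow> b * f s"
      unfolding f_def using b by (intro tendsto_mult_ennreal tendsto_const) auto
    then have "f s \<le> b * f s"
      using f_le_a by (intro LIMSEQ_le_const) auto
    moreover have "f s < \<infinity>" by (simp add: f_def less_top[symmetric])
    ultimately show ?thesis
      using b ennreal_mult_strict_right_mono[of b 1 "f s"] by (metis infinity_ennreal_def leD mult_1 not_gr_zero)
  qed
  then show ?thesis
    unfolding f_def using sets_f by (subst AE_iff_measurable[OF _ refl]) auto
qed

lemma AE_infinitely_often:
  fixes q :: "'a::countable \<Rightarrow> 'a \<Rightarrow> real"
  assumes q: "stochastic_matrix q" and hit: "\<And>s. AE \<omega> in chain_law q s. \<exists>n. \<omega> n = e"
  shows "AE \<omega> in chain_law q s. \<exists>\<^sub>\<infinity>n. \<omega> n = e"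
proof -
  have "AE \<omega> in chain_law q s. \<exists>n\<ge>m. \<omega> n = e" for m
  proof (induction m arbitrary: s)
    case 0
    show ?case using hit by simp
  next
    case (Suc m)
    show ?case
    proof (rule AE_chain_law_first_step[OF q])
      show "Measurable.pred path_space (\<lambda>\<omega>. \<exists>n\<ge>Suc m. \<omega> n = e)" by measurable
      show "AE \<omega> in chain_law q z. \<exists>n\<ge>Suc m. case_nat s \<omega> n = e" for z
        using Suc.IH[of z] by eventually_elim (auto intro: exI[of _ "Suc _"])
    qed
  qed
  then show ?thesis by (simp add: INFM_nat_le AE_all_countable)
qed


section \<open>The invariant measure\<close>

text \<open>By invariance, the zeros of \<open>\<pi>\<close> are inherited by predecessors, and \<open>\<pi>\<close> is not zero.\<close>

lemma invariant_measure_pos: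
  fixes p :: "'a::countable \<Rightarrow> 'a \<Rightarrow> real"
  assumes p: "stochastic_matrix p" and irr: "irreducible_chain p"
    and nonneg: "\<And>x. 0 \<le> \<pi> x" and inv: "invariant_measure p (\<lambda>x. ennreal (\<pi> x))"
  shows "\<pi> x > 0"
proof (rule ccontr)
  assume "\<not> \<pi> x > 0"
  have "y \<in> {x. \<pi> x = 0}" for y
  proof (rule irreducible_chain_predecessor_closed[OF p irr, of x])
    show "x \<in> {x. \<pi> x = 0}" using \<open>\<not> \<pi> x > 0\<close> nonneg[of x] by simp
    fix a z assume "p a z > 0" "z \<in> {x. \<pi> x = 0}"
    then have "(\<integral>\<^sup>+a. ennreal (\<pi> a) * ennreal (p a z) \<partial>count_space UNIV) = 0"
      using inv by (simp add: invariant_measure_def)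
    then have "ennreal (\<pi> a) * ennreal (p a z) = 0"
      by (simp add: nn_integral_0_iff_AE AE_count_space)
    then show "a \<in> {x. \<pi> x = 0}"
      using \<open>p a z > 0\<close> nonneg[of a] by (simp add: ennreal_eq_0_iff)
  qed
  then show False
    using inv by (simp add: invariant_measure_def)
qed

context
  fixes p :: "'a::countable \<Rightarrow> 'a \<Rightarrow> real" and \<pi> :: "'a \<Rightarrow> real"
  assumes p: "stochastic_matrix p" and irr: "irreducible_chain p" and rec: "recurrent_chain p"
begin

context
  assumes pos: "\<And>x. \<pi> x > 0" and inv: "invariant_measure p (\<lambda>x. ennreal (\<pi> x))"
begin

lemma cat_mouse_measure_diagonal: "cat_mouse_measure p \<pi> x x = ennreal (\<pi> x)"
  using inv
  by (simp add: cat_mouse_measure_eq_green[OF p pos inv] recurrent_green_eq_1[OF p irr rec]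
      invariant_measure_def)

lemma cat_mouse_measure_marginal:
  "(\<integral>\<^sup>+x. cat_mouse_measure p \<pi> x y \<partial>count_space UNIV) =
    stationary_expectation p \<pi> (\<lambda>\<omega>. ennreal (p (\<omega> 0) y) * ennreal_of_enat (hitting_time y \<omega>))"
proof -
  have "(\<integral>\<^sup>+\<omega>. ennreal (p (\<omega> 0) y) * ennreal_of_enat (hitting_time y \<omega>) \<partial>chain_law p z) =
      ennreal (p z y) * (\<integral>\<^sup>+x. green p y z x \<partial>count_space UNIV)" for z
  proof -
    have "(\<integral>\<^sup>+\<omega>. ennreal (p (\<omega> 0) y) * ennreal_of_enat (hitting_time y \<omega>) \<partial>chain_law p z) =
        (\<integral>\<^sup>+\<omega>. ennreal (p z y) * ennreal_of_enat (hitting_time y \<omega>) \<partial>chain_law p z)"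
      using AE_chain_law_start[OF p, of z] by (rule nn_integral_cong_AE[OF eventually_mono]) simp
    also have "\<dots> = ennreal (p z y) * (\<integral>\<^sup>+\<omega>. ennreal_of_enat (hitting_time y \<omega>) \<partial>chain_law p z)"
      by (rule nn_integral_cmult) (simp add: measurable_chain_law_cong)
    finally show ?thesis by (simp add: nn_integral_hitting_time[OF p])
  qed
  then have "stationary_expectation p \<pi> (\<lambda>\<omega>. ennreal (p (\<omega> 0) y) * ennreal_of_enat (hitting_time y \<omega>)) =
      (\<integral>\<^sup>+z. \<integral>\<^sup>+x. ennreal (\<pi> z) * ennreal (p z y) * green p y z x \<partial>count_space UNIV \<partial>count_space UNIV)"
    by (simp add: stationary_expectation_def nn_integral_cmult mult.assoc)
  also have "\<dots> = (\<integral>\<^sup>+x. cat_mouse_measure p \<pi> x y \<partial>count_space UNIV)"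
    unfolding cat_mouse_measure_eq_green[OF p pos inv] by (rule nn_integral_count_space_swap)
  finally show ?thesis ..
qed

text \<open>
  This is the invariance equation, written out: the first summand is the flow out of the diagonal, where
  \<open>\<nu> = \<pi>\<close> and both animals move, the second the flow out of the states in which the mouse sits
  at \<open>w\<close> and the cat is elsewhere.
\<close>

lemma cat_mouse_measure_last_step:
  "cat_mouse_measure p \<pi> z w =
    (\<integral>\<^sup>+a. ennreal (\<pi> a) * ennreal (p a z) * ennreal (p a w) \<partial>count_space UNIV) +
    (\<integral>\<^sup>+a. indicator (-{w}) a * cat_mouse_measure p \<pi> a w * ennreal (p a z) \<partial>count_space UNIV)"
proof -
  have "cat_mouse_measure p \<pi> z w =
      (\<integral>\<^sup>+a. ennreal (\<pi> a) * ennreal (p a z) * ennreal (p a w) +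
        (\<integral>\<^sup>+u. ennreal (\<pi> a) * ennreal (p a w) * green p w a u * (indicator (-{w}) u * ennreal (p u z))
          \<partial>count_space UNIV) \<partial>count_space UNIV)"
    unfolding cat_mouse_measure_eq_green[OF p pos inv]
  proof (rule nn_integral_cong)
    fix a
    have "ennreal (\<pi> a) * ennreal (p a w) * green p w a z =
        ennreal (\<pi> a) * ennreal (p a w) * ennreal (p a z) + ennreal (\<pi> a) * ennreal (p a w) *
        (\<integral>\<^sup>+u. green p w a u * (indicator (-{w}) u * ennreal (p u z)) \<partial>count_space UNIV)"
      by (subst green_last_step) (simp only: distrib_left)
    also have "ennreal (\<pi> a) * ennreal (p a w) *
        (\<integral>\<^sup>+u. green p w a u * (indicator (-{w}) u * ennreal (p u z)) \<partial>count_space UNIV) =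
        (\<integral>\<^sup>+u. ennreal (\<pi> a) * ennreal (p a w) * green p w a u * (indicator (-{w}) u * ennreal (p u z))
          \<partial>count_space UNIV)"
      by (subst nn_integral_cmult[symmetric]) (simp_all only: mult.assoc borel_measurable_count_space)
    finally show "ennreal (\<pi> a) * ennreal (p a w) * green p w a z =
        ennreal (\<pi> a) * ennreal (p a z) * ennreal (p a w) +
        (\<integral>\<^sup>+u. ennreal (\<pi> a) * ennreal (p a w) * green p w a u * (indicator (-{w}) u * ennreal (p u z))
          \<partial>count_space UNIV)"
      by (simp only: ac_simps)
  qed
  also have "\<dots> = (\<integral>\<^sup>+a. ennreal (\<pi> a) * ennreal (p a z) * ennreal (p a w) \<partial>count_space UNIV) +
      (\<integral>\<^sup>+a. \<integral>\<^sup>+u. ennreal (\<pi> a) * ennreal (p a w) * green p w a u * (indicator (-{w}) u * ennreal (p u z))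
          \<partial>count_space UNIV \<partial>count_space UNIV)"
    by (rule nn_integral_add) simp_all
  also have "(\<integral>\<^sup>+a. \<integral>\<^sup>+u. ennreal (\<pi> a) * ennreal (p a w) * green p w a u *
        (indicator (-{w}) u * ennreal (p u z)) \<partial>count_space UNIV \<partial>count_space UNIV) =
      (\<integral>\<^sup>+u. \<integral>\<^sup>+a. ennreal (\<pi> a) * ennreal (p a w) * green p w a u *
        (indicator (-{w}) u * ennreal (p u z)) \<partial>count_space UNIV \<partial>count_space UNIV)"
    by (rule nn_integral_count_space_swap)
  also have "\<dots> = (\<integral>\<^sup>+u. cat_mouse_measure p \<pi> u w * (indicator (-{w}) u * ennreal (p u z)) \<partial>count_space UNIV)"
    unfolding cat_mouse_measure_eq_green[OF p pos inv]
    by (intro nn_integral_cong nn_integral_multc) simp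
  finally show ?thesis by (simp only: ac_simps)
qed

text \<open>
  By \<open>cat_mouse_measure_last_step\<close>, \<open>\<nu>(u, y) p(u, z) \<le> \<nu>(z, y)\<close> for \<open>u \<noteq> y\<close>, so finiteness is inherited by
  predecessors, starting from \<open>\<nu>(y, y) = \<pi>(y)\<close>.
\<close>

lemma cat_mouse_measure_finite: "cat_mouse_measure p \<pi> x y < \<infinity>"
proof -
  have "x \<in> {x. cat_mouse_measure p \<pi> x y < \<infinity>}"
  proof (rule irreducible_chain_predecessor_closed[OF p irr, of y])
    show "y \<in> {x. cat_mouse_measure p \<pi> x y < \<infinity>}"
      by (simp add: cat_mouse_measure_diagonal)
    fix u z assume "p u z > 0" and z: "z \<in> {x. cat_mouse_measure p \<pi> x y < \<infinity>}"
    show "u \<in> {x. cat_mouse_measure p \<pi> x y < \<infinity>}"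
    proof (cases "u = y")
      case False
      then have "cat_mouse_measure p \<pi> u y * ennreal (p u z) =
          indicator (-{y}) u * cat_mouse_measure p \<pi> u y * ennreal (p u z)"
        by simp
      also have "\<dots> \<le> (\<integral>\<^sup>+a. indicator (-{y}) a * cat_mouse_measure p \<pi> a y * ennreal (p a z) \<partial>count_space UNIV)"
        by (rule nn_integral_ge_point) simp
      also have "\<dots> \<le> cat_mouse_measure p \<pi> z y"
        by (subst cat_mouse_measure_last_step[of z y]) simp
      also have "\<dots> < \<infinity>" using z by simp
      finally show ?thesis
        using \<open>p u z > 0\<close> by (auto simp: ennreal_mult_less_top)
    qed (simp add: cat_mouse_measure_diagonal)
  qed
  then show ?thesis by simp
qed

lemma cat_mouse_measure_invariant:
  "invariant_measure (cat_mouse p) (\<lambda>(x, y). cat_mouse_measure p \<pi> x y)"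
  unfolding invariant_measure_def
proof (intro conjI allI)
  show "\<exists>s. (case s of (x, y) \<Rightarrow> cat_mouse_measure p \<pi> x y) \<noteq> 0"
    using pos by (intro exI[of _ "(undefined, undefined)"])
      (simp add: cat_mouse_measure_diagonal ennreal_eq_0_iff not_le)
  show "(case s of (x, y) \<Rightarrow> cat_mouse_measure p \<pi> x y) < \<infinity>" for s
    using cat_mouse_measure_finite by (cases s) simp
  fix t :: "'a \<times> 'a"
  obtain z w where t: "t = (z, w)" by force
  have p_nonneg: "0 \<le> p a b" for a b using p by (simp add: stochastic_matrix_def)
  have weight: "cat_mouse_measure p \<pi> a b * ennreal (cat_mouse p (a, b) (z, w)) =
      ennreal (\<pi> a) * ennreal (p a z) * ennreal (p a w) * indicator {a} b +
      indicator (-{w}) a * cat_mouse_measure p \<pi> a w * ennreal (p a z) * indicator {w} b" for a b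
    by (auto simp: cat_mouse_def cat_mouse_measure_diagonal ennreal_mult p_nonneg mult.assoc)
  have "(\<integral>\<^sup>+s. (case s of (x, y) \<Rightarrow> cat_mouse_measure p \<pi> x y) * ennreal (cat_mouse p s t) \<partial>count_space UNIV) =
      (\<integral>\<^sup>+a. \<integral>\<^sup>+b. cat_mouse_measure p \<pi> a b * ennreal (cat_mouse p (a, b) (z, w))
        \<partial>count_space UNIV \<partial>count_space UNIV)"
    by (subst nn_integral_fst_count_space[symmetric]) (simp add: t)
  also have "\<dots> = (\<integral>\<^sup>+a. ennreal (\<pi> a) * ennreal (p a z) * ennreal (p a w) +
      indicator (-{w}) a * cat_mouse_measure p \<pi> a w * ennreal (p a z) \<partial>count_space UNIV)"
    unfolding weight by (intro nn_integral_cong) (subst nn_integral_add, simp_all add: nn_integral_cmult_indicator)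
  also have "\<dots> = cat_mouse_measure p \<pi> z w"
    unfolding cat_mouse_measure_last_step[of z w] by (rule nn_integral_add) simp_all
  finally show "(\<integral>\<^sup>+s. (case s of (x, y) \<Rightarrow> cat_mouse_measure p \<pi> x y) * ennreal (cat_mouse p s t) \<partial>count_space UNIV) =
      (case t of (x, y) \<Rightarrow> cat_mouse_measure p \<pi> x y)"
    by (simp add: t)
qed

end

section \<open>Recurrence\<close>

lemma nn_integral_cat_mouse_apart:
  assumes "x \<noteq> y"
  shows "(\<integral>\<^sup>+t. ennreal (cat_mouse p (x, y) t) * u t \<partial>count_space UNIV) =
    (\<integral>\<^sup>+z. ennreal (p x z) * u (z, y) \<partial>count_space UNIV)"
proof -
  have "ennreal (cat_mouse p (x, y) (z, w)) * u (z, w) = ennreal (p x z) * u (z, y) * indicator {y} w" for z w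
    using assms by (simp add: cat_mouse_def)
  then show ?thesis
    by (subst nn_integral_fst_count_space[symmetric]) (simp add: nn_integral_cmult_indicator)
qed

lemma nn_integral_cat_mouse_together:
  "(\<integral>\<^sup>+t. ennreal (cat_mouse p (y, y) t) * u t \<partial>count_space UNIV) =
    (\<integral>\<^sup>+w. ennreal (p y w) * (\<integral>\<^sup>+z. ennreal (p y z) * u (z, w) \<partial>count_space UNIV) \<partial>count_space UNIV)"
proof -
  have "ennreal (cat_mouse p (y, y) (z, w)) * u (z, w) = ennreal (p y w) * (ennreal (p y z) * u (z, w))" for z w
    using p by (simp add: cat_mouse_def stochastic_matrix_def ennreal_mult ac_simps)
  then show ?thesis
    by (subst nn_integral_snd_count_space[symmetric]) (simp add: nn_integral_cmult)
qed

text \<open>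
  Any state \<open>(t, t)\<close> is visited almost surely from any \<open>(x, y)\<close>, and from there \<open>e\<close> can still be reached.
  Instead of following the paths, the proof compares values of the superharmonic function
  \<open>hit_prob\<close>, first along the cat for a fixed mouse and then along the diagonal.
\<close>

lemma hit_prob_cat_mouse_ge:
  "hit_prob (cat_mouse p) e (t, t) \<le> hit_prob (cat_mouse p) e (x, y)"
proof -
  let ?h = "hit_prob (cat_mouse p) e"
  have q: "stochastic_matrix (cat_mouse p)" by (rule stochastic_cat_mouse[OF p])
  have super: "u y \<le> u x"
    if "\<And>x. x \<noteq> y \<Longrightarrow> (\<integral>\<^sup>+z. ennreal (p x z) * u z \<partial>count_space UNIV) \<le> u x" for u :: "'a \<Rightarrow> ennreal" and x y
    using superharmonic_green_le[of y p u x, OF that] recurrent_green_eq_1[OF p irr rec, of y x]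
    by (cases "x = y") auto
  have meet: "?h (y, y) \<le> ?h (x, y)" for x y
  proof (rule super)
    fix x assume "x \<noteq> y"
    then show "(\<integral>\<^sup>+z. ennreal (p x z) * ?h (z, y) \<partial>count_space UNIV) \<le> ?h (x, y)"
      using hit_prob_superharmonic[OF q, of "(x, y)" e] by (simp add: nn_integral_cat_mouse_apart)
  qed
  have "?h (t, t) \<le> ?h (y, y)"
  proof (rule super[of t "\<lambda>y. ?h (y, y)"])
    fix y
    \<comment> \<open>After both have left \<open>y\<close>, the position \<open>z\<close> of the cat matters only up to \<open>meet\<close>.\<close>
    have "(\<integral>\<^sup>+w. ennreal (p y w) * ?h (w, w) \<partial>count_space UNIV) =
        (\<integral>\<^sup>+w. ennreal (p y w) * (\<integral>\<^sup>+z. ennreal (p y z) * ?h (w, w) \<partial>count_space UNIV) \<partial>count_space UNIV)"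
      using p by (simp add: nn_integral_multc stochastic_matrix_def)
    also have "\<dots> \<le> (\<integral>\<^sup>+w. ennreal (p y w) * (\<integral>\<^sup>+z. ennreal (p y z) * ?h (z, w) \<partial>count_space UNIV) \<partial>count_space UNIV)"
      by (intro nn_integral_mono mult_left_mono meet) auto
    also have "\<dots> \<le> ?h (y, y)"
      using hit_prob_superharmonic[OF q, of "(y, y)" e] by (simp add: nn_integral_cat_mouse_together)
    finally show "(\<integral>\<^sup>+w. ennreal (p y w) * ?h (w, w) \<partial>count_space UNIV) \<le> ?h (y, y)" .
  qed
  also have "\<dots> \<le> ?h (x, y)" by (rule meet)
  finally show ?thesis .
qed

text \<open>
  A path of the cat from \<open>z\<close> to \<open>x\<close> that avoids \<open>y\<close> in between, combined with a first step of the mouse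
  from \<open>z\<close> to \<open>y\<close>, is a path of the pair chain from \<open>(z, z)\<close> to \<open>(x, y)\<close>.
\<close>

lemma hit_prob_cat_mouse_diagonal_pos:
  assumes "p z y > 0" "taboo p y n z x \<noteq> 0" "hit_prob (cat_mouse p) e (x, y) \<noteq> 0"
  shows "hit_prob (cat_mouse p) e (z, z) \<noteq> 0"
  using assms(2,3)
proof (induction n arbitrary: x)
  case 0
  then have "cat_mouse p (z, z) (x, y) > 0"
    using \<open>p z y > 0\<close> by (simp add: cat_mouse_def ennreal_eq_0_iff not_le)
  then show ?case
    using "0.prems"(2) by (rule hit_prob_pos_step[OF stochastic_cat_mouse[OF p]])
next
  case (Suc n)
  obtain u where u: "taboo p y n z u * (indicator (-{y}) u * ennreal (p u x)) \<noteq> 0"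
    using Suc.prems(1) unfolding taboo_Suc_right by (auto simp: nn_integral_0_iff_AE AE_count_space)
  then have "u \<noteq> y" "p u x > 0" "taboo p y n z u \<noteq> 0"
    by (auto simp: ennreal_eq_0_iff not_le indicator_def split: if_splits)
  then have "cat_mouse p (u, y) (x, y) > 0" by (simp add: cat_mouse_def)
  then have "hit_prob (cat_mouse p) e (u, y) \<noteq> 0"
    using Suc.prems(2) by (rule hit_prob_pos_step[OF stochastic_cat_mouse[OF p]])
  with \<open>taboo p y n z u \<noteq> 0\<close> show ?case by (rule Suc.IH)
qed

lemma cat_mouse_recurrent:
  assumes pos: "\<And>x. \<pi> x > 0" and inv: "invariant_measure p (\<lambda>x. ennreal (\<pi> x))"
    and nz: "cat_mouse_measure p \<pi> x y \<noteq> 0"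
  shows "AE \<omega> in chain_law (cat_mouse p) s. \<exists>\<^sub>\<infinity>n. \<omega> n = (x, y)"
proof -
  have q: "stochastic_matrix (cat_mouse p)" by (rule stochastic_cat_mouse[OF p])
  obtain z where z: "ennreal (\<pi> z) * ennreal (p z y) * green p y z x \<noteq> 0"
    using nz unfolding cat_mouse_measure_eq_green[OF p pos inv]
    by (auto simp: nn_integral_0_iff_AE AE_count_space)
  then have "green p y z x \<noteq> 0" by auto
  then obtain n where "taboo p y n z x \<noteq> 0"
    unfolding green_def by fastforce
  moreover have "p z y > 0" using z by (auto simp: ennreal_eq_0_iff not_le)
  moreover have "hit_prob (cat_mouse p) (x, y) (x, y) \<noteq> 0"
    by (simp add: hit_prob_eq[OF q])
  ultimately have "hit_prob (cat_mouse p) (x, y) (z, z) \<noteq> 0"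
    by (intro hit_prob_cat_mouse_diagonal_pos)
  then have "hit_prob (cat_mouse p) (x, y) (z, z) > 0" by (simp add: zero_less_iff_neq_zero)
  moreover have "hit_prob (cat_mouse p) (x, y) (z, z) \<le> hit_prob (cat_mouse p) (x, y) s" for s
    using hit_prob_cat_mouse_ge by (cases s) simp
  ultimately have "AE \<omega> in chain_law (cat_mouse p) s. \<exists>n. \<omega> n = (x, y)" for s
    by (rule AE_hit_of_hit_prob_bounded_below[OF q])
  then show ?thesis by (rule AE_infinitely_often[OF q])
qed

end

theorem theorem1:
  fixes p :: "'a::countable \<Rightarrow> 'a \<Rightarrow> real" and \<pi> :: "'a \<Rightarrow> real"
  assumes "stochastic_matrix p"
    and "irreducible_chain p"
    and "aperiodic_chain p"
    and "recurrent_chain p"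
    and "\<forall>x. p x x = 0"
    and "\<forall>x. 0 \<le> \<pi> x"
    and "invariant_measure p (\<lambda>x. ennreal (\<pi> x))"
  shows "invariant_measure (cat_mouse p) (\<lambda>(x, y). cat_mouse_measure p \<pi> x y) \<and>
    (\<forall>s. AE \<omega> in chain_law (cat_mouse p) s.
       \<forall>x y. cat_mouse_measure p \<pi> x y \<noteq> 0 \<longrightarrow> (\<exists>\<^sub>\<infinity>n. \<omega> n = (x, y))) \<and>
    (\<forall>y. (\<integral>\<^sup>+x. cat_mouse_measure p \<pi> x y \<partial>count_space UNIV) =
       stationary_expectation p \<pi>
         (\<lambda>\<omega>. ennreal (p (\<omega> 0) y) * ennreal_of_enat (hitting_time y \<omega>))) \<and>
    (\<forall>x. cat_mouse_measure p \<pi> x x = ennreal (\<pi> x))"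
proof -
  note chain = assms(1,2,4) and inv = assms(7)
  have pos: "\<pi> x > 0" for x
    using assms(6) by (intro invariant_measure_pos[OF assms(1,2) _ inv]) simp
  have "AE \<omega> in chain_law (cat_mouse p) s.
      \<forall>x y. cat_mouse_measure p \<pi> x y \<noteq> 0 \<longrightarrow> (\<exists>\<^sub>\<infinity>n. \<omega> n = (x, y))" for s
    using cat_mouse_recurrent[OF chain pos inv]
    by (auto simp: AE_all_countable)
  then show ?thesis
    using cat_mouse_measure_invariant[OF chain pos inv]
      cat_mouse_measure_marginal[OF chain pos inv] cat_mouse_measure_diagonal[OF chain pos inv]
    by blast
qed

end
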